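(* Assume that $\mu_1(n_1+n_2)\le\mu_1(n_1)\mu_1(n_2)$ for all integers $n_1,n_2\ge 3$. Let $n\ge 3$ be an integer, let $j\in\{0,1,2\}$ with $n\equiv j\pmod 3$, let $t$ be a nonnegative integer, and suppose $n\ge 4(3t+j)$. Put $$E_t^{(j)}=\bigcup_{i=1}^{4t+j}\Bigl\{6^{\frac{n-j-3i}{3}}\,y:\ y\in\pi_{3i+j;4},\ y\ge 9^{3t+j}6^{\,i-4t-j}\Bigr\}.$$ Then the elements of $E_t^{(j)}$, listed in decreasing order, are exactly the $|E_t^{(j)}|$ largest values of the permanent on $\Lambda_n^3$; that is, $E_t^{(j)}\subseteq ps[\Lambda_n^3]$ and every element of $ps[\Lambda_n^3]\setminus E_t^{(j)}$ is smaller than every element of $E_t^{(j)}$.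
   Context: $\Lambda_n^3$ is the class of $n\times n$ $(0,1)$-matrices with exactly three $1$'s in each row and in each column; $ps[\Lambda_n^3]$ is the set of all values of the permanent on $\Lambda_n^3$. $\Lambda_{s,1}^3$ is the set of completely indecomposable matrices in $\Lambda_s^3$, i.e. matrices of $\Lambda_s^3$ containing no submatrix belonging to $\Lambda_m^3$ with $m<s$. $\mu_1(s)$ is the maximum of the permanent on $\Lambda_{s,1}^3$ ($s\ge3$). For an integer $m\ge 4$, $\pi_{m;4}$ is the set of all products $\prod_i x_{\rho_i}$, where $\rho:\ m=\rho_1+\rho_2+\cdots$ runs over all partitions of $m$ into parts each at least $4$ and each $x_{\rho_i}$ runs (independently for each part) over all values of the permanent on $\Lambda_{\rho_i,1}^3$ (so $\pi_{5;4}$, for instance, consists of the values of the permanent on $\Lambda_{5,1}^3$). By convention $\pi_{3;4}=\{6\}$. *)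

theory Defs
  imports
    "HOL-Library.Multiset"
    "HOL-Number_Theory.Cong"
    "Jordan_Normal_Form.Matrix"
    "Jordan_Normal_Form.DL_Submatrix"
begin

definition permanent :: "'a :: comm_semiring_1 mat \<Rightarrow> 'a" where
  "permanent A = (if dim_row A = dim_col A
     then \<Sum>p | p permutes {0..<dim_row A}. \<Prod>i = 0..<dim_row A. A $$ (i, p i)
     else 0)"

definition Lambda3 :: "nat \<Rightarrow> nat mat set" where
  "Lambda3 n = {A \<in> carrier_mat n n.
     (\<forall>i<n. \<forall>j<n. A $$ (i, j) \<in> {0, 1}) \<and>
     (\<forall>i<n. card {j. j < n \<and> A $$ (i, j) = 1} = 3) \<and>
     (\<forall>j<n. card {i. i < n \<and> A $$ (i, j) = 1} = 3)}"

definition ps :: "nat mat set \<Rightarrow> nat set" where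
  "ps S = permanent ` S"

(* The condition 0 < m is needed because the empty matrix vacuously lies in Lambda3 0. *)
definition indec_Lambda3 :: "nat \<Rightarrow> nat mat set" where
  "indec_Lambda3 s = {A \<in> Lambda3 s.
     \<not> (\<exists>m I J. 0 < m \<and> m < s \<and> I \<subseteq> {0..<s} \<and> J \<subseteq> {0..<s} \<and>
              submatrix A I J \<in> Lambda3 m)}"

(* For s \<ge> 3 the set below is finite and nonempty, so this is a genuine maximum. *)
definition mu1 :: "nat \<Rightarrow> nat" where
  "mu1 s = Max (ps (indec_Lambda3 s))"

(* rho is a partition of m into parts \<ge> 4. The multiset X arises from rho by replacing each
   occurrence of a part r by some permanent value on indec_Lambda3 r, chosen independently for
   each occurrence. The value at 3 is a convention; values at m < 3 are never used. *)
definition pi4 :: "nat \<Rightarrow> nat set" where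
  "pi4 m = (if m = 3 then {6}
     else {prod_mset X | rho X. sum_mset rho = m \<and> (\<forall>r \<in># rho. 4 \<le> r) \<and>
             rel_mset (\<lambda>r x. x \<in> ps (indec_Lambda3 r)) rho X})"

(* Used only when n is congruent to j mod 3 and n \<ge> 4 * (3 * t + j); then n - j - 3 * i is
   a nonnegative multiple of 3 for every i in range, so neither - nor div truncates. The
   exponent i - 4t - j in the lower bound is nonpositive, hence the integer power over real. *)
definition E :: "nat \<Rightarrow> nat \<Rightarrow> nat \<Rightarrow> nat set" where
  "E n j t = (\<Union>i\<in>{1..4 * t + j}.
     {6 ^ ((n - j - 3 * i) div 3) * y | y. y \<in> pi4 (3 * i + j) \<and>
        real y \<ge> 9 ^ (3 * t + j) * 6 powi (int i - 4 * int t - int j)})"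

end

(*
  Every value on Lambda3 n is 6^a * y with n = 3 a + m and y a product of permanents of completely
  indecomposable blocks of sizes r >= 4 with sum m.  The key estimate is mu1 r ^ 2 <= 3 ^ r for r >= 4:
  for r = 4, ..., 7 it follows from the bounds 9, 15, 27, 46 on the permanent, and for r >= 8 from
  mu1 r <= mu1 4 * mu1 (r - 4).  Hence y ^ 2 <= 3 ^ m.  For m = 4 k + 3 e with e > 0 this gives
  y < 9 ^ k * 6 ^ e because 27 < 36, so that for k = 3 t + j every value with more than 4 t + j in
  place of i lies below the threshold that defines E, while the values with smaller i lie in E
  unless they are below that threshold.

  The bounds for r <= 7 come from expanding along a column: its three rows contribute three pairs of
  further columns, and the permanent is a sum of at most 12 minors of order r - 3 <= 4, each of
  which has few ones.  Indecomposability enters only through the absence of three equal rows.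
*)
theory Submission
  imports Defs "HOL-Combinatorics.List_Permutation"
begin

text \<open>The estimate is stated for squares because the comparison is between growth rates per
  row: \<open>sqrt 3\<close> for a block of order 4, whose bound satisfies \<open>9^2 = 3^4\<close>
  exactly, and the cube root of 6, which is larger, for a block of order 3.

  The obstacle is that blocks of order 3 violate the estimate: \<open>mu1 3 = 6\<close>, and 36 >
  27. Submultiplicativity may therefore only be applied with both parts at least 4. Splitting 6 as 3
  + 3 or 7 as 3 + 4 would give 36 and 54, while 27 and 46 are the largest admissible values. This is
  why all four orders 4 to 7 need direct bounds, with order 7 the most laborious.

  These bounds are proved for lists of sets instead of matrices: a minor is then a set difference,
  rows can be reordered as a multiset, and columns keep their names, so no indices have to be
  shifted. Matrices are translated into row supports once, and blocks of a matrix become pairs of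
  index sets that are closed under the relation "the entry is 1".\<close>

section \<open>Permanents as numbers of systems of distinct representatives\<close>

text \<open>The number of systems of distinct representatives of a list of sets, that is, the permanent of
  a 0-1 matrix given by its row supports.\<close>
definition sdr :: "'a set list \<Rightarrow> nat" where
  "sdr Ss = card {xs. distinct xs \<and> list_all2 (\<in>) xs Ss}"

lemma sdr_Nil [simp]: "sdr [] = 1"
proof -
  have "{xs::'a list. distinct xs \<and> list_all2 (\<in>) xs []} = {[]}" by auto
  then show ?thesis by (simp add: sdr_def)
qed

lemma list_all2_set_subset:
  assumes "list_all2 (\<in>) xs Ss"
  shows "set xs \<subseteq> \<Union>(set Ss)"
  using assms by (induction rule: list_all2_induct) auto

lemma finite_sdr:
  assumes "\<forall>S\<in>set Ss. finite S"
  shows "finite {xs. distinct xs \<and> list_all2 (\<in>) xs Ss}"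
proof -
  have "finite {xs. set xs \<subseteq> \<Union>(set Ss) \<and> length xs = length Ss}"
    using assms by (intro finite_lists_length_eq) auto
  moreover have "{xs. distinct xs \<and> list_all2 (\<in>) xs Ss}
      \<subseteq> {xs. set xs \<subseteq> \<Union>(set Ss) \<and> length xs = length Ss}"
    using list_all2_set_subset list_all2_lengthD by blast
  ultimately show ?thesis by (rule rev_finite_subset)
qed

text \<open>Laplace expansion along the first row: choosing the representative \<open>x\<close>
  deletes that column from all other rows.\<close>

lemma sdr_Cons:
  assumes "finite S" "\<forall>T\<in>set Ss. finite T"
  shows "sdr (S # Ss) = (\<Sum>x\<in>S. sdr (map (\<lambda>T. T - {x}) Ss))"
proof -
  let ?X = "\<lambda>x. {xs. distinct xs \<and> list_all2 (\<in>) xs (map (\<lambda>T. T - {x}) Ss)}"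
  have iff: "list_all2 (\<in>) xs (map (\<lambda>T. T - {x}) Ss) \<longleftrightarrow> x \<notin> set xs \<and> list_all2 (\<in>) xs Ss"
    for x xs
    by (auto simp: list_all2_conv_all_nth in_set_conv_nth)
  have eq: "{xs. distinct xs \<and> list_all2 (\<in>) xs (S # Ss)} = (\<Union>x\<in>S. (#) x ` ?X x)"
    by (auto simp: iff list_all2_Cons2 image_iff)
  have fin: "finite (?X x)" for x
    using assms by (intro finite_sdr) auto
  have "sdr (S # Ss) = (\<Sum>x\<in>S. card ((#) x ` ?X x))"
    unfolding sdr_def eq using assms fin by (intro card_UN_disjoint) auto
  also have "\<dots> = (\<Sum>x\<in>S. sdr (map (\<lambda>T. T - {x}) Ss))"
    by (intro sum.cong) (auto simp: sdr_def card_image)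
  finally show ?thesis .
qed

text \<open>Permuting the sets and their representatives simultaneously is a bijection, undone by
  the inverse permutation. It serves to sort rows and to move chosen rows to the front.\<close>

lemma sdr_mset_cong:
  assumes "mset Ss = mset Ts"
  shows "sdr Ss = sdr Ts"
proof -
  obtain p where p: "p permutes {..<length Ts}" "permute_list p Ts = Ss"
    using mset_eq_permutation[OF assms] by blast
  have len: "length Ss = length Ts" using assms by (rule mset_eq_length)
  have q: "Hilbert_Choice.inv p permutes {..<length Ts}" (is "?q permutes _")
    using p(1) by (rule permutes_inv)
  have step: "list_all2 (\<in>) (permute_list r xs) (permute_list r Us)"
    if "r permutes {..<length Us}" "list_all2 (\<in>) xs Us" for r xs and Us :: "'a set list"
    using that by (simp add: list_all2_permute_list_iff list_all2_lengthD)
  have inv: "permute_list ?q (permute_list p xs) = xs" "permute_list p (permute_list ?q xs) = xs"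
    if "length xs = length Ts" for xs :: "'a list"
    using that p(1) q permutes_inv_o[OF p(1)] permute_list_compose[of p xs ?q] permute_list_compose[of ?q xs p]
    by simp_all
  have Ts: "permute_list ?q Ss = Ts"
    using p permutes_inv_o[OF p(1)] permute_list_compose[OF q, of p] by simp
  let ?X = "\<lambda>Us :: 'a set list. {xs. distinct xs \<and> list_all2 (\<in>) xs Us}"
  have "bij_betw (permute_list p) (?X Ts) (?X Ss)"
  proof (rule bij_betw_byWitness[where f' = "permute_list ?q"])
    show "\<forall>xs\<in>?X Ts. permute_list ?q (permute_list p xs) = xs"
      using inv by (auto dest: list_all2_lengthD)
    show "\<forall>xs\<in>?X Ss. permute_list p (permute_list ?q xs) = xs"
      using inv len by (auto dest: list_all2_lengthD)
    show "permute_list p ` ?X Ts \<subseteq> ?X Ss"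
    proof clarify
      fix xs assume xs: "distinct xs" "list_all2 (\<in>) xs Ts"
      then show "distinct (permute_list p xs) \<and> list_all2 (\<in>) (permute_list p xs) Ss"
        using step[OF p(1) xs(2)] p list_all2_lengthD[OF xs(2)] by simp
    qed
    show "permute_list ?q ` ?X Ss \<subseteq> ?X Ts"
    proof clarify
      fix xs assume xs: "distinct xs" "list_all2 (\<in>) xs Ss"
      have "?q permutes {..<length Ss}" using q len by simp
      from step[OF this xs(2)] show "distinct (permute_list ?q xs) \<and> list_all2 (\<in>) (permute_list ?q xs) Ts"
        using xs(1) q len list_all2_lengthD[OF xs(2)] unfolding Ts by simp
    qed
  qed
  then show ?thesis unfolding sdr_def by (simp add: bij_betw_same_card)
qed

text \<open>Columns get relabelled in two places: by \<open>pick J\<close> when a submatrix is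
  compared with rows of the full matrix, and by a shift when two matrices are joined
  block-diagonally.\<close>

lemma sdr_image:
  assumes "inj_on g (\<Union>(set Ss))"
  shows "sdr (map (image g) Ss) = sdr Ss"
proof -
  let ?X = "{xs. distinct xs \<and> list_all2 (\<in>) xs Ss}"
  have sub: "set xs \<subseteq> \<Union>(set Ss)" if "list_all2 (\<in>) xs Ss" for xs
    using that by (rule list_all2_set_subset)
  have "{xs. distinct xs \<and> list_all2 (\<in>) xs (map (image g) Ss)} = map g ` ?X" (is "?L = ?R")
  proof
    show "?R \<subseteq> ?L"
    proof clarify
      fix xs assume xs: "distinct xs" "list_all2 (\<in>) xs Ss"
      then show "distinct (map g xs) \<and> list_all2 (\<in>) (map g xs) (map (image g) Ss)"
        using inj_on_subset[OF assms sub[OF xs(2)]]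
        by (auto simp: distinct_map list_all2_conv_all_nth)
    qed
    show "?L \<subseteq> ?R"
    proof
      fix ys assume ys: "ys \<in> ?L"
      then have "\<forall>i<length Ss. \<exists>x\<in>Ss ! i. ys ! i = g x"
        by (auto simp: list_all2_conv_all_nth image_iff)
      then obtain h where h: "\<forall>i<length Ss. h i \<in> Ss ! i \<and> ys ! i = g (h i)" by metis
      have len: "length ys = length Ss" using ys by (auto dest: list_all2_lengthD)
      have "ys = map g (map h [0..<length Ss])"
        using h len by (intro nth_equalityI) auto
      moreover have "map h [0..<length Ss] \<in> ?X"
        using ys calculation h by (auto simp: list_all2_conv_all_nth distinct_map intro: inj_on_imageI2)
      ultimately show "ys \<in> ?R" by blast
    qed
  qed
  moreover have "inj_on (map g) ?X"
    using assms sub by (intro inj_on_mapI inj_on_subset[OF assms]) blast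
  ultimately show ?thesis by (simp add: sdr_def card_image)
qed

lemma sdr_append:
  assumes "\<Union>(set Ss) \<inter> \<Union>(set Ts) = {}"
  shows "sdr (Ss @ Ts) = sdr Ss * sdr Ts"
proof -
  let ?X = "\<lambda>Ss. {xs. distinct xs \<and> list_all2 (\<in>) xs Ss}"
  have sub: "set xs \<subseteq> \<Union>(set Ss)" if "list_all2 (\<in>) xs Ss" for xs and Ss :: "'a set list"
    using that by (rule list_all2_set_subset)
  have "bij_betw (\<lambda>(xs, ys). xs @ ys) (?X Ss \<times> ?X Ts) (?X (Ss @ Ts))"
  proof (rule bij_betw_imageI)
    show "inj_on (\<lambda>(xs, ys). xs @ ys) (?X Ss \<times> ?X Ts)"
      by (auto simp: inj_on_def dest!: list_all2_lengthD)
    show "(\<lambda>(xs, ys). xs @ ys) ` (?X Ss \<times> ?X Ts) = ?X (Ss @ Ts)"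
    proof (intro equalityI subsetI)
      fix zs assume "zs \<in> (\<lambda>(xs, ys). xs @ ys) ` (?X Ss \<times> ?X Ts)"
      then obtain xs ys where zs: "zs = xs @ ys" and x: "distinct xs" "list_all2 (\<in>) xs Ss"
        and y: "distinct ys" "list_all2 (\<in>) ys Ts" by auto
      have "set xs \<inter> set ys = {}" using sub[OF x(2)] sub[OF y(2)] assms by blast
      then show "zs \<in> ?X (Ss @ Ts)"
        using zs x y by (simp add: list_all2_appendI)
    next
      fix zs assume zs: "zs \<in> ?X (Ss @ Ts)"
      then obtain xs ys where "zs = xs @ ys" "list_all2 (\<in>) xs Ss" "list_all2 (\<in>) ys Ts"
        by (auto simp: list_all2_append2)
      then show "zs \<in> (\<lambda>(xs, ys). xs @ ys) ` (?X Ss \<times> ?X Ts)"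
        using zs by auto
    qed
  qed
  then show ?thesis
    unfolding sdr_def by (simp add: card_cartesian_product flip: bij_betw_same_card)
qed

text \<open>Pigeonhole. This kills the terms of the column expansion in which no row uses the
  expanded column.\<close>

lemma sdr_eq_0:
  assumes "\<Union>(set Ss) \<subseteq> C" "finite C" "card C < length Ss"
  shows "sdr Ss = 0"
proof -
  have False if "distinct xs" "list_all2 (\<in>) xs Ss" for xs
  proof -
    have "set xs \<subseteq> C"
      using list_all2_set_subset[OF that(2)] assms(1) by blast
    then have "card (set xs) \<le> card C" using assms(2) by (rule card_mono[rotated])
    then show False using that assms(3) distinct_card list_all2_lengthD by fastforce
  qed
  then show ?thesis unfolding sdr_def by (metis (mono_tags, lifting) card.empty empty_Collect_eq)
qed

definition row_supp :: "nat mat \<Rightarrow> nat \<Rightarrow> nat set" where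
  "row_supp A i = {j. j < dim_col A \<and> A $$ (i, j) = 1}"

lemma permanent_eq_sdr:
  assumes "A \<in> carrier_mat n n" "\<forall>i<n. \<forall>j<n. A $$ (i, j) \<in> {0, 1 :: nat}"
  shows "permanent A = sdr (map (row_supp A) [0..<n])"
proof -
  let ?P = "{p. p permutes {0..<n} \<and> (\<forall>i<n. A $$ (i, p i) = 1)}"
  have dims: "dim_row A = n" "dim_col A = n" using assms(1) by auto
  have prod: "(\<Prod>i = 0..<n. A $$ (i, p i)) = of_bool (\<forall>i<n. A $$ (i, p i) = 1)"
    if "p permutes {0..<n}" for p
  proof (cases "\<forall>i<n. A $$ (i, p i) = 1")
    case False
    then obtain i where "i < n" "A $$ (i, p i) \<noteq> 1" by auto
    moreover have "p i < n" using permutes_in_image[OF that, of i] \<open>i < n\<close> by simp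
    ultimately have "A $$ (i, p i) = 0" using assms(2) by auto
    then show ?thesis using False \<open>i < n\<close> by (auto intro!: prod_zero)
  qed simp
  have "permanent A = (\<Sum>p | p permutes {0..<n}. of_bool (\<forall>i<n. A $$ (i, p i) = 1))"
    unfolding permanent_def dims using prod by (auto intro: sum.cong)
  also have "\<dots> = card ?P"
    by (subst sum_of_bool_eq) (auto simp: finite_permutations Int_def)
  also have "\<dots> = sdr (map (row_supp A) [0..<n])"
    unfolding sdr_def
  proof (rule bij_betw_same_card, rule bij_betw_imageI)
    let ?f = "\<lambda>p. map p [0..<n]"
    show "inj_on ?f ?P"
    proof (rule inj_onI)
      fix p q assume pq: "p \<in> ?P" "q \<in> ?P" "?f p = ?f q"
      then have "p i = q i" if "i < n" for i using that by simp
      moreover have "p i = q i" if "\<not> i < n" for i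
        using pq that by (auto simp: permutes_def)
      ultimately show "p = q" by auto
    qed
    show "?f ` ?P = {xs. distinct xs \<and> list_all2 (\<in>) xs (map (row_supp A) [0..<n])}" (is "?L = ?R")
    proof
      show "?L \<subseteq> ?R"
    proof
      fix xs assume "xs \<in> ?L"
      then obtain p where p: "p permutes {0..<n}" "\<forall>i<n. A $$ (i, p i) = 1" "xs = map p [0..<n]"
        by auto
      have "p i < n" if "i < n" for i
        using permutes_in_image[OF p(1), of i] that by simp
      then show "xs \<in> ?R"
        using p permutes_inj_on[OF p(1)]
        by (simp add: distinct_map row_supp_def dims list_all2_conv_all_nth)
    qed
      show "?R \<subseteq> ?L"
      proof
        fix xs assume xs: "xs \<in> ?R"
        \<comment> \<open>A permutation has to fix everything outside \<open>{0..<n}\<close>, hence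
          the default value \<open>i\<close>.\<close>
        define p where "p i = (if i < n then xs ! i else i)" for i
        have len: "length xs = n" using xs by (auto dest: list_all2_lengthD)
        have ent: "p i < n \<and> A $$ (i, p i) = 1" if "i < n" for i
          using xs that len by (auto simp: list_all2_conv_all_nth row_supp_def dims p_def)
        have inj: "inj_on p {0..<n}"
          using xs len by (auto simp: inj_on_def p_def nth_eq_iff_index_eq)
        have "p permutes {0..<n}"
          by (rule inj_on_nat_permutes[OF inj]) (use ent in \<open>auto simp: p_def\<close>)
        moreover have "xs = map p [0..<n]"
          using len by (intro nth_equalityI) (auto simp: p_def)
        ultimately show "xs \<in> ?L" using ent by blast
      qed
    qed
  qed
  finally show ?thesis .
qed

section \<open>Small 0-1 matrices with few ones\<close>

text \<open>With the sum taken over all of \<open>D\<close>, a permanent of fixed order unfolds into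
  a polynomial in the truth values of membership, which can be checked by cases.\<close>

lemma sdr_Cons_subset:
  assumes "finite D" "S \<subseteq> D" "\<forall>T\<in>set Ss. T \<subseteq> D"
  shows "sdr (S # Ss) = (\<Sum>x\<in>D. if x \<in> S then sdr (map (\<lambda>T. T - {x}) Ss) else 0)"
proof -
  have "sdr (S # Ss) = (\<Sum>x\<in>S. sdr (map (\<lambda>T. T - {x}) Ss))"
    using assms by (intro sdr_Cons) (auto intro: finite_subset)
  also have "\<dots> = (\<Sum>x\<in>D. if x \<in> S then sdr (map (\<lambda>T. T - {x}) Ss) else 0)"
    using assms by (simp add: sum.inter_restrict[symmetric] Int_absorb1)
  finally show ?thesis .
qed

lemma sdr1:
  assumes "finite S"
  shows "sdr [S] = card S"
  using assms by (simp add: sdr_Cons)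

lemma card_subset_sum:
  assumes "finite D" "A \<subseteq> D"
  shows "card A = (\<Sum>x\<in>D. of_bool (x \<in> A))"
  using assms by (simp add: Int_absorb1)

lemma sdr_2_bound:
  assumes D: "card D = 2" and sub: "A \<subseteq> D" "B \<subseteq> D"
  shows "sdr [A, B] \<le> (if card A + card B \<le> 3 then 1 else 2)"
proof -
  obtain p q where pq: "D = {p, q}" "p \<noteq> q" using D by (auto simp: card_2_iff)
  have c: "card S = of_bool (p \<in> S) + of_bool (q \<in> S)" if "S \<subseteq> D" for S
    using card_subset_sum[of D S] that pq by simp
  have e: "sdr (S # Ss) = (if p \<in> S then sdr (map (\<lambda>T. T - {p}) Ss) else 0)
      + (if q \<in> S then sdr (map (\<lambda>T. T - {q}) Ss) else 0)"
    if "S \<subseteq> D" "\<forall>T\<in>set Ss. T \<subseteq> D" for S Ss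
    using sdr_Cons_subset[of D S Ss] that pq by simp
  have "sdr [A, B] = of_bool (p \<in> A \<and> q \<in> B) + of_bool (q \<in> A \<and> p \<in> B)"
  proof -
    have "B - {p} \<subseteq> D" "B - {q} \<subseteq> D" using sub by auto
    then show ?thesis using sub pq by (simp add: e)
  qed
  then show ?thesis using sub by (simp add: c)
qed

text \<open>Permanent and number of ones are both explicit in nine truth values. The first three
  bounds reflect how many of the six diagonals survive one, two or three zeros. In the fourth, a
  column with at most one 1 leaves a single minor of order 2; \<open>p\<close> may be any column,
  since the enumeration of \<open>D\<close> is arbitrary.\<close>

lemma sdr_3_bounds:
  assumes D: "D = {p, q, r}" "card D = 3" and sub: "A \<subseteq> D" "B \<subseteq> D" "C \<subseteq> D"
  shows "card A + card B + card C \<le> 8 \<Longrightarrow> sdr [A, B, C] \<le> 4"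
    and "card A + card B + card C \<le> 7 \<Longrightarrow> sdr [A, B, C] \<le> 3"
    and "card A + card B + card C \<le> 6 \<Longrightarrow> sdr [A, B, C] \<le> 2"
    and "of_bool (p \<in> A) + of_bool (p \<in> B) + of_bool (p \<in> C) \<le> (1 :: nat) \<Longrightarrow> sdr [A, B, C] \<le> 2"
    and "p \<notin> A \<Longrightarrow> p \<notin> B \<Longrightarrow> p \<notin> C \<Longrightarrow> sdr [A, B, C] = 0"
proof -
  have ne: "p \<noteq> q" "p \<noteq> r" "q \<noteq> r"
    using D by (auto simp: card_insert_if split: if_splits)
  have c: "card S = of_bool (p \<in> S) + of_bool (q \<in> S) + of_bool (r \<in> S)" if "S \<subseteq> D" for S
    using card_subset_sum[of D S] that ne D by simp
  have e: "sdr (S # Ss) = (if p \<in> S then sdr (map (\<lambda>T. T - {p}) Ss) else 0)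
      + (if q \<in> S then sdr (map (\<lambda>T. T - {q}) Ss) else 0)
      + (if r \<in> S then sdr (map (\<lambda>T. T - {r}) Ss) else 0)"
    if "S \<subseteq> D" "\<forall>T\<in>set Ss. T \<subseteq> D" for S Ss
    using sdr_Cons_subset[of D S Ss] that ne D(1) by simp
  have s: "sdr [A, B, C] =
      of_bool (p \<in> A \<and> q \<in> B \<and> r \<in> C) + of_bool (p \<in> A \<and> r \<in> B \<and> q \<in> C) +
      of_bool (q \<in> A \<and> p \<in> B \<and> r \<in> C) + of_bool (q \<in> A \<and> r \<in> B \<and> p \<in> C) +
      of_bool (r \<in> A \<and> p \<in> B \<and> q \<in> C) + of_bool (r \<in> A \<and> q \<in> B \<and> p \<in> C)"
  proof -
    have "B - {x} \<subseteq> D" "C - {x} \<subseteq> D" "C - {x} - {y} \<subseteq> D" for x y using sub by auto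
    then show ?thesis using sub ne ne[symmetric] by (simp add: e)
  qed
  note cs = c[OF sub(1)] c[OF sub(2)] c[OF sub(3)]
  show "sdr [A, B, C] = 0" if "p \<notin> A" "p \<notin> B" "p \<notin> C"
    using that by (simp add: s)
  show "sdr [A, B, C] \<le> 2" if "of_bool (p \<in> A) + of_bool (p \<in> B) + of_bool (p \<in> C) \<le> (1 :: nat)"
    using that unfolding s by (cases "p \<in> A"; cases "p \<in> B"; cases "p \<in> C") auto
  show "sdr [A, B, C] \<le> 4" if "card A + card B + card C \<le> 8"
    using that unfolding s cs
    by (cases "p \<in> A"; cases "q \<in> A"; cases "r \<in> A"; cases "p \<in> B"; cases "q \<in> B"; cases "r \<in> B") auto
  show "sdr [A, B, C] \<le> 3" if "card A + card B + card C \<le> 7"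
    using that unfolding s cs
    by (cases "p \<in> A"; cases "q \<in> A"; cases "r \<in> A"; cases "p \<in> B"; cases "q \<in> B"; cases "r \<in> B") auto
  show "sdr [A, B, C] \<le> 2" if "card A + card B + card C \<le> 6"
    using that unfolding s cs
    by (cases "p \<in> A"; cases "q \<in> A"; cases "r \<in> A"; cases "p \<in> B"; cases "q \<in> B"; cases "r \<in> B") auto
qed

lemma card_Diff_single_add: 
  assumes "finite T" 
  shows "card (T - {x}) + of_bool (x \<in> T) = card T"
  using card_Suc_Diff1[OF assms, of x] by (cases "x \<in> T") simp_all

text \<open>Expand along a row \<open>T1\<close> with fewest ones: the minor for \<open>x\<close> has \<open>d x\<close> ones fewer than the other
  three rows together, and it is small if its column \<open>y\<close> contains at most one \<open>1\<close>.\<close>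
lemma sdr_4_bounds_sorted:
  assumes D: "card D = 4" and sub: "T1 \<subseteq> D" "T2 \<subseteq> D" "T3 \<subseteq> D" "T4 \<subseteq> D"
    and le3: "card T2 \<le> 3" "card T3 \<le> 3" "card T4 \<le> 3"
    and min: "card T1 \<le> card T2" "card T1 \<le> card T3" "card T1 \<le> card T4"
    and ne: "\<not> (T2 = T3 \<and> T3 = T4 \<and> card T2 = 3)"
  defines "s \<equiv> card T1 + card T2 + card T3 + card T4"
  shows "s = 8 \<Longrightarrow> sdr [T1, T2, T3, T4] \<le> 4"
    and "s = 8 \<Longrightarrow> card T1 \<noteq> 2 \<Longrightarrow> sdr [T1, T2, T3, T4] \<le> 3"
    and "s = 9 \<Longrightarrow> sdr [T1, T2, T3, T4] \<le> 4"
    and "s = 10 \<Longrightarrow> sdr [T1, T2, T3, T4] \<le> 5"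
    and "s = 11 \<Longrightarrow> sdr [T1, T2, T3, T4] \<le> 6"
proof -
  have finD: "finite D" using D by (auto intro: card_ge_0_finite)
  have fin: "finite T1" "finite T2" "finite T3" "finite T4"
    using sub finD by (auto intro: finite_subset)
  define G where "G x = sdr [T2 - {x}, T3 - {x}, T4 - {x}]" for x
  define d :: "'a \<Rightarrow> nat" where
    "d x = of_bool (x \<in> T2) + of_bool (x \<in> T3) + of_bool (x \<in> T4)" for x
  define t where "t = card T2 + card T3 + card T4"
  have expand: "sdr [T1, T2, T3, T4] = (\<Sum>x\<in>T1. G x)"
    using fin by (simp add: sdr_Cons G_def)
  have card_D': "card (D - {x}) = 3" if "x \<in> D" for x using D that finD by simp
  have sub': "T2 - {x} \<subseteq> D - {x}" "T3 - {x} \<subseteq> D - {x}" "T4 - {x} \<subseteq> D - {x}" for x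
    using sub by auto
  have cards: "card (T2 - {x}) + card (T3 - {x}) + card (T4 - {x}) + d x = t" for x
    using card_Diff_single_add[OF fin(2), of x] card_Diff_single_add[OF fin(3), of x]
      card_Diff_single_add[OF fin(4), of x] by (simp add: d_def t_def)
  have G: "(t \<le> d x + 8 \<longrightarrow> G x \<le> 4) \<and> (t \<le> d x + 7 \<longrightarrow> G x \<le> 3) \<and> (t \<le> d x + 6 \<longrightarrow> G x \<le> 2)"
    if x: "x \<in> D" for x
  proof -
    obtain p q r where pqr: "D - {x} = {p, q, r}" using card_D'[OF x] by (auto simp: card_3_iff)
    show ?thesis
      using sdr_3_bounds(1-3)[OF pqr card_D'[OF x] sub'[of x]] cards[of x] by (auto simp: G_def)
  qed
  have G': "(d y \<le> 1 \<longrightarrow> G x \<le> 2) \<and> (d y = 0 \<longrightarrow> G x = 0)"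
    if xy: "x \<in> D" "y \<in> D" "x \<noteq> y" for x y
  proof -
    have "card (D - {x} - {y}) = 2" using card_D'[of x] xy finD by simp
    then obtain q r where "D - {x} - {y} = {q, r}" by (auto simp: card_2_iff)
    then have yqr: "D - {x} = {y, q, r}" using xy by auto
    show ?thesis
      using sdr_3_bounds(4,5)[OF yqr card_D'[OF xy(1)] sub'[of x]] xy(3) by (auto simp: G_def d_def)
  qed
  \<comment> \<open>The only use of \<open>ne\<close>: if \<open>t = 9\<close>, the last three rows
    have three ones each among four columns, so a column missing from all of them would make them
    equal.\<close>
  have all9: "d x > 0" if "t = 9" "x \<in> D" for x
  proof (rule ccontr)
    assume "\<not> d x > 0"
    then have "T2 \<subseteq> D - {x}" "T3 \<subseteq> D - {x}" "T4 \<subseteq> D - {x}" using sub by (auto simp: d_def)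
    moreover have "card T2 = 3" "card T3 = 3" "card T4 = 3" using that le3 by (auto simp: t_def)
    ultimately have "T2 = D - {x}" "T3 = D - {x}" "T4 = D - {x}"
      using card_D'[OF that(2)] finD by (metis card_subset_eq finite_Diff)+
    then show False using ne \<open>card T2 = 3\<close> by simp
  qed
  have s: "s = card T1 + t" by (simp add: s_def t_def)
  have t3: "3 * card T1 \<le> t" using min by (simp add: t_def)
  have t9: "t \<le> 9" using le3 by (simp add: t_def)
  have z: "sdr [T1, T2, T3, T4] = 0" if "T1 = {}"
    using that expand by simp
  have one: "card T1 = 1 \<and> sdr [T1, T2, T3, T4] = G x \<and>
      (t \<le> d x + 8 \<longrightarrow> G x \<le> 4) \<and> (t \<le> d x + 7 \<longrightarrow> G x \<le> 3) \<and> (t = 9 \<longrightarrow> 1 \<le> d x)" if "T1 = {x}" for x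
    using that expand G[of x] all9[of x] sub(1) by (simp add: Suc_le_eq)
  have two: "card T1 = 2 \<and> sdr [T1, T2, T3, T4] = G x + G y \<and>
      (t \<le> d x + 8 \<longrightarrow> G x \<le> 4) \<and> (t \<le> d x + 7 \<longrightarrow> G x \<le> 3) \<and> (t \<le> d x + 6 \<longrightarrow> G x \<le> 2) \<and>
      (t \<le> d y + 8 \<longrightarrow> G y \<le> 4) \<and> (t \<le> d y + 7 \<longrightarrow> G y \<le> 3) \<and> (t \<le> d y + 6 \<longrightarrow> G y \<le> 2) \<and>
      (d y \<le> 1 \<longrightarrow> G x \<le> 2) \<and> (d y = 0 \<longrightarrow> G x = 0) \<and>
      (d x \<le> 1 \<longrightarrow> G y \<le> 2) \<and> (d x = 0 \<longrightarrow> G y = 0) \<and>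
      (t = 9 \<longrightarrow> 1 \<le> d x) \<and> (t = 9 \<longrightarrow> 1 \<le> d y)" if "T1 = {x, y}" "x \<noteq> y" for x y
    using that expand G[of x] G[of y] G'[of x y] G'[of y x] all9[of x] all9[of y] sub(1) by (simp add: Suc_le_eq)
  have b: "(s = 8 \<longrightarrow> sdr [T1, T2, T3, T4] \<le> 4) \<and>
      (s = 8 \<longrightarrow> card T1 \<noteq> 2 \<longrightarrow> sdr [T1, T2, T3, T4] \<le> 3) \<and>
      (s = 9 \<longrightarrow> sdr [T1, T2, T3, T4] \<le> 4) \<and>
      (s = 10 \<longrightarrow> sdr [T1, T2, T3, T4] \<le> 5) \<and>
      (s = 11 \<longrightarrow> sdr [T1, T2, T3, T4] \<le> 6)"
  proof -
    consider "card T1 = 0" | "card T1 = 1" | "card T1 = 2" | "card T1 \<ge> 3" by linarith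
    then show ?thesis
    proof cases
      case 1
      then have "T1 = {}" using fin by simp
      then show ?thesis using z by simp
    next
      case 2
      then obtain x where x: "T1 = {x}" by (rule card_1_singletonE)
      have "d x \<le> 3" by (simp add: d_def)
      then show ?thesis using one[OF x] s t9 by presburger
    next
      case 3
      then obtain x y where xy: "T1 = {x, y}" "x \<noteq> y" by (auto simp: card_2_iff)
      note f = two[OF xy]
      have g: "t \<le> d x + 8 \<Longrightarrow> G x \<le> 4" "t \<le> d x + 7 \<Longrightarrow> G x \<le> 3" "t \<le> d x + 6 \<Longrightarrow> G x \<le> 2"
        "t \<le> d y + 8 \<Longrightarrow> G y \<le> 4" "t \<le> d y + 7 \<Longrightarrow> G y \<le> 3" "t \<le> d y + 6 \<Longrightarrow> G y \<le> 2"
        "d x \<le> 1 \<Longrightarrow> G y \<le> 2" "d x = 0 \<Longrightarrow> G y = 0" "d y \<le> 1 \<Longrightarrow> G x \<le> 2" "d y = 0 \<Longrightarrow> G x = 0"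
        "t = 9 \<Longrightarrow> 1 \<le> d x" "t = 9 \<Longrightarrow> 1 \<le> d y"
        using f by blast+
      \<comment> \<open>Here \<open>t = s - 2\<close>. A column with few ones makes the other minor
        small, one with many ones leaves few in its own minor. For \<open>t = 9\<close>, say,
        \<open>d x = 1\<close> gives 4 + 2, while \<open>d x\<close> and \<open>d y\<close> both at
        least 2 give 3 + 3.\<close>
      have "G x + G y \<le> 4" if "t = 6"
        using g(3,6) that by simp
      moreover have "G x + G y \<le> 4" if "t = 7"
        using g(2,3,5,6,8,10) that by (cases "d x = 0"; cases "d y = 0") simp_all
      moreover have "G x + G y \<le> 5" if "t = 8"
        using g(1-10) that
        by (cases "d x = 0"; cases "d y = 0"; cases "d x = 1"; cases "d y = 1") simp_all
      moreover have "G x + G y \<le> 6" if "t = 9"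
        using g that by (cases "d x = 1"; cases "d y = 1") simp_all
      moreover have "card T1 = 2" "sdr [T1, T2, T3, T4] = G x + G y" using f by blast+
      ultimately show ?thesis using s by auto
    next
      \<comment> \<open>Minimality of \<open>T1\<close> now forces \<open>s \<ge> 12\<close>,
        outside the range of all five claims.\<close>
      case 4
      then show ?thesis using s t3 by simp
    qed
  qed
  show "s = 8 \<Longrightarrow> sdr [T1, T2, T3, T4] \<le> 4" "s = 9 \<Longrightarrow> sdr [T1, T2, T3, T4] \<le> 4"
    "s = 8 \<Longrightarrow> card T1 \<noteq> 2 \<Longrightarrow> sdr [T1, T2, T3, T4] \<le> 3"
    "s = 10 \<Longrightarrow> sdr [T1, T2, T3, T4] \<le> 5" "s = 11 \<Longrightarrow> sdr [T1, T2, T3, T4] \<le> 6"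
    using b by blast+
qed

text \<open>Sorting the rows by size puts a smallest one first; excluding three equal rows of size 3
  anywhere excludes them among the last three.\<close>

lemma sdr_4_bounds:
  assumes D: "card D = 4" and len: "length Ts = 4" and sub: "\<forall>T\<in>set Ts. T \<subseteq> D"
    and le3: "\<forall>T\<in>set Ts. card T \<le> 3"
    and ne: "\<And>S. card S = 3 \<Longrightarrow> count (mset Ts) S \<le> 2"
  defines "s \<equiv> sum_list (map card Ts)"
  shows "s = 8 \<Longrightarrow> sdr Ts \<le> 4"
    and "s = 8 \<Longrightarrow> \<exists>T\<in>set Ts. card T \<noteq> 2 \<Longrightarrow> sdr Ts \<le> 3"
    and "s = 9 \<Longrightarrow> sdr Ts \<le> 4"
    and "s = 10 \<Longrightarrow> sdr Ts \<le> 5"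
    and "s = 11 \<Longrightarrow> sdr Ts \<le> 6"
proof -
  define Us where "Us = sort_key card Ts"
  have ms: "mset Us = mset Ts" by (simp add: Us_def)
  then have set: "set Us = set Ts" by (rule mset_eq_setD)
  have "length Us = 4" using len by (simp add: Us_def)
  then obtain T1 T2 T3 T4 where Us: "Us = [T1, T2, T3, T4]"
    by (auto simp: length_Suc_conv numeral_eq_Suc)
  have "sorted (map card Us)" by (simp add: Us_def)
  then have min: "card T1 \<le> card T2" "card T1 \<le> card T3" "card T1 \<le> card T4" by (auto simp: Us)
  have sdr: "sdr Ts = sdr [T1, T2, T3, T4]" using sdr_mset_cong[OF ms] by (simp add: Us)
  have mT: "mset Ts = mset [T1, T2, T3, T4]" using ms by (simp add: Us)
  have "sum_mset (image_mset card (mset Ts)) = card T1 + card T2 + card T3 + card T4"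
    unfolding mT by simp
  then have s: "s = card T1 + card T2 + card T3 + card T4"
    unfolding s_def by (simp flip: sum_mset_sum_list)
  have sT: "set Ts = {T1, T2, T3, T4}" using set by (simp add: Us)
  have sub': "T1 \<subseteq> D" "T2 \<subseteq> D" "T3 \<subseteq> D" "T4 \<subseteq> D" using sub sT by auto
  have le3': "card T2 \<le> 3" "card T3 \<le> 3" "card T4 \<le> 3" using le3 sT by auto
  have ne': "\<not> (T2 = T3 \<and> T3 = T4 \<and> card T2 = 3)"
    using ne[of T2] unfolding mT by (auto split: if_splits)
  note b = sdr_4_bounds_sorted[OF D sub' le3' min ne', folded s]
  show "s = 8 \<Longrightarrow> sdr Ts \<le> 4" "s = 9 \<Longrightarrow> sdr Ts \<le> 4" "s = 10 \<Longrightarrow> sdr Ts \<le> 5"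
    "s = 11 \<Longrightarrow> sdr Ts \<le> 6"
    using b(1,3,4,5) by (simp_all add: sdr)
  show "sdr Ts \<le> 3" if "s = 8" "\<exists>T\<in>set Ts. card T \<noteq> 2"
  proof -
    \<comment> \<open>If the smallest of four sizes with sum 8 were 2, all four would be 2.\<close>
    have "card T1 \<noteq> 2" using that s min unfolding sT by auto
    then show ?thesis using b(2) that by (simp add: sdr)
  qed
qed

section \<open>Expansion along a column\<close>

text \<open>For three rows through a common column, \<open>F x y\<close> will be the minor left when
  two of them choose \<open>x\<close> and \<open>y\<close> and the third takes the common column.
  Equal choices are not allowed and count 0.\<close>

definition pair_sum :: "('a \<Rightarrow> 'a \<Rightarrow> nat) \<Rightarrow> 'a set \<Rightarrow> 'a set \<Rightarrow> nat" where
  "pair_sum F P Q = (\<Sum>x\<in>P. \<Sum>y\<in>Q. if x = y then 0 else F x y)"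

text \<open>The number of ones that column \<open>x\<close> loses with the three rows. If the pairs
  are viewed as edges of a multigraph, this is the degree of \<open>x\<close>.\<close>

definition mult3 :: "'a set \<Rightarrow> 'a set \<Rightarrow> 'a set \<Rightarrow> 'a \<Rightarrow> nat" where
  "mult3 P1 P2 P3 x = of_bool (x \<in> P1) + of_bool (x \<in> P2) + of_bool (x \<in> P3)"

lemma pair_sum_commute:
  assumes "\<And>x y. F x y = F y x"
  shows "pair_sum F P Q = pair_sum F Q P"
  unfolding pair_sum_def by (subst sum.swap) (auto intro!: sum.cong simp: assms)

lemma pair_sum_doubletons:
  assumes "x \<noteq> y" "u \<noteq> v"
  shows "pair_sum F {x, y} {u, v} =
    (if x = u then 0 else F x u) + (if x = v then 0 else F x v) +
    (if y = u then 0 else F y u) + (if y = v then 0 else F y v)"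
  using assms by (simp add: pair_sum_def)

lemma card_2_member:
  assumes "card P = 2" "x \<in> P"
  obtains y where "P = {x, y}" "x \<noteq> y"
proof -
  obtain a b where "P = {a, b}" "a \<noteq> b" using assms(1) by (auto simp: card_2_iff)
  then show ?thesis using assms(2) that[of a] that[of b] by auto
qed

text \<open>The hypotheses \<open>three\<close> and \<open>four\<close> list the totals that occur for the possible intersection patterns
  of three pairs, of which the first two meet.\<close>
lemma pair_sum_overlap12:
  assumes c: "card P1 = 2" "card P2 = 2" "card P3 = 2"
    and ne: "\<not> (P1 = P2 \<and> P2 = P3)" and ov: "P1 \<inter> P2 \<noteq> {}"
    and bound: "\<And>x y. x \<in> P1 \<union> P2 \<union> P3 \<Longrightarrow> y \<in> P1 \<union> P2 \<union> P3 \<Longrightarrow> x \<noteq> y \<Longrightarrow>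
      F x y \<le> \<phi> (mult3 P1 P2 P3 x + mult3 P1 P2 P3 y)"
    and three: "card (P1 \<union> P2 \<union> P3) = 3 \<Longrightarrow> 9 * \<phi> 4 \<le> K \<and> 4 * \<phi> 5 + 2 * \<phi> 4 + 2 * \<phi> 3 \<le> K"
    and four: "card (P1 \<union> P2 \<union> P3) \<ge> 4 \<Longrightarrow> \<phi> 2 + 6 * \<phi> 3 + 3 * \<phi> 4 \<le> K \<and>
      6 * \<phi> 4 + 3 * \<phi> 2 \<le> K \<and> 6 * \<phi> 3 + 5 * \<phi> 2 \<le> K \<and> 2 * \<phi> 4 + 8 * \<phi> 3 \<le> K"
  shows "pair_sum F P1 P2 + pair_sum F P1 P3 + pair_sum F P2 P3 \<le> (K :: nat)"
proof -
  obtain x where x: "x \<in> P1" "x \<in> P2" using ov by blast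
  obtain y where y: "P1 = {x, y}" "x \<noteq> y" using card_2_member[OF c(1) x(1)] .
  obtain z where z: "P2 = {x, z}" "x \<noteq> z" using card_2_member[OF c(2) x(2)] .
  obtain u v where uv: "P3 = {u, v}" "u \<noteq> v" using c(3) by (auto simp: card_2_iff)
  \<comment> \<open>The pairs as edges: in cases 1 to 3 the first two are parallel, in 4 to 10 they
    share only \<open>x\<close>. A parallel pair and an edge meeting it (1, 2, 4, 5) gives
    \<open>4 * \<phi> 5 + 2 * \<phi> 4 + 2 * \<phi> 3\<close>, the triangle (6)
    \<open>9 * \<phi> 4\<close>, a parallel pair and a disjoint edge (3)
    \<open>2 * \<phi> 4 + 8 * \<phi> 3\<close>, the star (7)
    \<open>6 * \<phi> 4 + 3 * \<phi> 2\<close>, the path of three edges (8, 9)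
    \<open>\<phi> 2 + 6 * \<phi> 3 + 3 * \<phi> 4\<close>, and a path of two edges with a disjoint
    edge (10) \<open>6 * \<phi> 3 + 5 * \<phi> 2\<close>.\<close>
  consider (1) w where "y = z" "P3 = {x, w}" "w \<noteq> x" "w \<noteq> y"
    | (2) w where "y = z" "P3 = {y, w}" "w \<noteq> x" "w \<noteq> y"
    | (3) "y = z" "x \<notin> P3" "y \<notin> P3"
    | (4) "y \<noteq> z" "P3 = {x, y}"
    | (5) "y \<noteq> z" "P3 = {x, z}"
    | (6) "y \<noteq> z" "P3 = {y, z}"
    | (7) w where "y \<noteq> z" "P3 = {x, w}" "w \<noteq> x" "w \<noteq> y" "w \<noteq> z"
    | (8) w where "y \<noteq> z" "P3 = {y, w}" "w \<noteq> x" "w \<noteq> y" "w \<noteq> z"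
    | (9) w where "y \<noteq> z" "P3 = {z, w}" "w \<noteq> x" "w \<noteq> y" "w \<noteq> z"
    | (10) "y \<noteq> z" "x \<notin> P3" "y \<notin> P3" "z \<notin> P3"
  proof (cases "y = z")
    case True
    then have P3: "P3 \<noteq> {x, y}" using ne y z by auto
    consider w where "P3 = {x, w}" "x \<noteq> w" | w where "x \<notin> P3" "P3 = {y, w}" "y \<noteq> w"
      | "x \<notin> P3" "y \<notin> P3"
      using card_2_member[OF c(3)] by metis
    then show thesis
    proof cases
      case (1 w)
      then show thesis using that(1)[of w] True P3 by auto
    next
      case (2 w)
      then show thesis using that(2)[of w] True by auto
    next
      case 3
      then show thesis using that(3) True by blast
    qed
  next
    case False
    consider w where "P3 = {x, w}" "x \<noteq> w" | w where "x \<notin> P3" "P3 = {y, w}" "y \<noteq> w"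
      | w where "x \<notin> P3" "y \<notin> P3" "P3 = {z, w}" "z \<noteq> w"
      | "x \<notin> P3" "y \<notin> P3" "z \<notin> P3"
      using card_2_member[OF c(3)] by metis
    then show thesis
    proof cases
      case (1 w)
      then show thesis using that(4,5) that(7)[of w] False by auto
    next
      case (2 w)
      then show thesis using that(6) that(8)[of w] False by auto
    next
      case (3 w)
      then show thesis using that(9)[of w] False by auto
    next
      case 4
      then show thesis using that(10) False by blast
    qed
  qed
  then show ?thesis
  proof cases
    case (1 w)
    note d0 = y(2) 1(3-4)
    note d = d0 d0[symmetric]
    note e = y(1) z(1)[folded 1(1)] 1(2)
    have U: "P1 \<union> P2 \<union> P3 = {x, y, w}" using e by auto
    have n: "card (P1 \<union> P2 \<union> P3) = 3" unfolding U using d by simp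
    have m: "mult3 P1 P2 P3 x = 3" "mult3 P1 P2 P3 y = 2" "mult3 P1 P2 P3 w = 1"
      using d by (simp_all add: mult3_def e)
    have "F x w \<le> \<phi> 4" "F x y \<le> \<phi> 5" "F y w \<le> \<phi> 3" "F y x \<le> \<phi> 5"
      using bound[of x w] bound[of x y] bound[of y w] bound[of y x] d by (simp_all add: U m eval_nat_numeral)
    then show ?thesis
      using three n d by (simp add: e pair_sum_doubletons)
  next
    case (2 w)
    note d0 = y(2) 2(3-4)
    note d = d0 d0[symmetric]
    note e = y(1) z(1)[folded 2(1)] 2(2)
    have U: "P1 \<union> P2 \<union> P3 = {x, y, w}" using e by auto
    have n: "card (P1 \<union> P2 \<union> P3) = 3" unfolding U using d by simp
    have m: "mult3 P1 P2 P3 x = 2" "mult3 P1 P2 P3 y = 3" "mult3 P1 P2 P3 w = 1"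
      using d by (simp_all add: mult3_def e)
    have "F x w \<le> \<phi> 3" "F x y \<le> \<phi> 5" "F y w \<le> \<phi> 4" "F y x \<le> \<phi> 5"
      using bound[of x w] bound[of x y] bound[of y w] bound[of y x] d by (simp_all add: U m eval_nat_numeral)
    then show ?thesis
      using three n d by (simp add: e pair_sum_doubletons)
  next
    case 3
    have "x \<noteq> u" "x \<noteq> v" "y \<noteq> u" "y \<noteq> v" using 3 uv(1) by auto
    note d0 = this uv(2) y(2)
    note d = d0 d0[symmetric]
    note e = y(1) z(1)[folded 3(1)] uv(1)
    have U: "P1 \<union> P2 \<union> P3 = {x, y, u, v}" using e by auto
    have n: "card (P1 \<union> P2 \<union> P3) = 4" unfolding U using d by simp
    have m: "mult3 P1 P2 P3 x = 2" "mult3 P1 P2 P3 y = 2" "mult3 P1 P2 P3 u = 1" "mult3 P1 P2 P3 v = 1"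
      using d by (simp_all add: mult3_def e)
    have "F x u \<le> \<phi> 3" "F x v \<le> \<phi> 3" "F x y \<le> \<phi> 4" "F y u \<le> \<phi> 3" "F y v \<le> \<phi> 3" "F y x \<le> \<phi> 4"
      using bound[of x u] bound[of x v] bound[of x y] bound[of y u] bound[of y v] bound[of y x] d by (simp_all add: U m eval_nat_numeral)
    then show ?thesis
      using four n d by (simp add: e pair_sum_doubletons)
  next
    case 4
    note d0 = y(2) z(2) 4(1)
    note d = d0 d0[symmetric]
    note e = y(1) z(1) 4(2)
    have U: "P1 \<union> P2 \<union> P3 = {x, y, z}" using e by auto
    have n: "card (P1 \<union> P2 \<union> P3) = 3" unfolding U using d by simp
    have m: "mult3 P1 P2 P3 x = 3" "mult3 P1 P2 P3 y = 2" "mult3 P1 P2 P3 z = 1"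
      using d by (simp_all add: mult3_def e)
    have "F x y \<le> \<phi> 5" "F x z \<le> \<phi> 4" "F y x \<le> \<phi> 5" "F y z \<le> \<phi> 3" "F z x \<le> \<phi> 4" "F z y \<le> \<phi> 3"
      using bound[of x y] bound[of x z] bound[of y x] bound[of y z] bound[of z x] bound[of z y] d by (simp_all add: U m eval_nat_numeral)
    then show ?thesis
      using three n d by (simp add: e pair_sum_doubletons)
  next
    case 5
    note d0 = y(2) z(2) 5(1)
    note d = d0 d0[symmetric]
    note e = y(1) z(1) 5(2)
    have U: "P1 \<union> P2 \<union> P3 = {x, y, z}" using e by auto
    have n: "card (P1 \<union> P2 \<union> P3) = 3" unfolding U using d by simp
    have m: "mult3 P1 P2 P3 x = 3" "mult3 P1 P2 P3 y = 1" "mult3 P1 P2 P3 z = 2"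
      using d by (simp_all add: mult3_def e)
    have "F x z \<le> \<phi> 5" "F y x \<le> \<phi> 4" "F y z \<le> \<phi> 3" "F z x \<le> \<phi> 5"
      using bound[of x z] bound[of y x] bound[of y z] bound[of z x] d by (simp_all add: U m eval_nat_numeral)
    then show ?thesis
      using three n d by (simp add: e pair_sum_doubletons)
  next
    case 6
    note d0 = y(2) z(2) 6(1)
    note d = d0 d0[symmetric]
    note e = y(1) z(1) 6(2)
    have U: "P1 \<union> P2 \<union> P3 = {x, y, z}" using e by auto
    have n: "card (P1 \<union> P2 \<union> P3) = 3" unfolding U using d by simp
    have m: "mult3 P1 P2 P3 x = 2" "mult3 P1 P2 P3 y = 2" "mult3 P1 P2 P3 z = 2"
      using d by (simp_all add: mult3_def e)
    have "F x y \<le> \<phi> 4" "F x z \<le> \<phi> 4" "F y x \<le> \<phi> 4" "F y z \<le> \<phi> 4" "F z y \<le> \<phi> 4"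
      using bound[of x y] bound[of x z] bound[of y x] bound[of y z] bound[of z y] d by (simp_all add: U m eval_nat_numeral)
    then show ?thesis
      using three n d by (simp add: e pair_sum_doubletons)
  next
    case (7 w)
    note d0 = y(2) z(2) 7(1) 7(3-5)
    note d = d0 d0[symmetric]
    note e = y(1) z(1) 7(2)
    have U: "P1 \<union> P2 \<union> P3 = {x, y, z, w}" using e by auto
    have n: "card (P1 \<union> P2 \<union> P3) = 4" unfolding U using d by simp
    have m: "mult3 P1 P2 P3 x = 3" "mult3 P1 P2 P3 y = 1" "mult3 P1 P2 P3 z = 1" "mult3 P1 P2 P3 w = 1"
      using d by (simp_all add: mult3_def e)
    have "F x w \<le> \<phi> 4" "F x z \<le> \<phi> 4" "F y w \<le> \<phi> 2" "F y x \<le> \<phi> 4" "F y z \<le> \<phi> 2" "F z w \<le> \<phi> 2" "F z x \<le> \<phi> 4"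
      using bound[of x w] bound[of x z] bound[of y w] bound[of y x] bound[of y z] bound[of z w] bound[of z x] d by (simp_all add: U m eval_nat_numeral)
    then show ?thesis
      using four n d by (simp add: e pair_sum_doubletons)
  next
    case (8 w)
    note d0 = y(2) z(2) 8(1) 8(3-5)
    note d = d0 d0[symmetric]
    note e = y(1) z(1) 8(2)
    have U: "P1 \<union> P2 \<union> P3 = {x, y, z, w}" using e by auto
    have n: "card (P1 \<union> P2 \<union> P3) = 4" unfolding U using d by simp
    have m: "mult3 P1 P2 P3 x = 2" "mult3 P1 P2 P3 y = 2" "mult3 P1 P2 P3 z = 1" "mult3 P1 P2 P3 w = 1"
      using d by (simp_all add: mult3_def e)
    have "F x w \<le> \<phi> 3" "F x y \<le> \<phi> 4" "F x z \<le> \<phi> 3" "F y w \<le> \<phi> 3" "F y x \<le> \<phi> 4" "F y z \<le> \<phi> 3" "F z w \<le> \<phi> 2" "F z y \<le> \<phi> 3"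
      using bound[of x w] bound[of x y] bound[of x z] bound[of y w] bound[of y x] bound[of y z] bound[of z w] bound[of z y] d by (simp_all add: U m eval_nat_numeral)
    then show ?thesis
      using four n d by (simp add: e pair_sum_doubletons)
  next
    case (9 w)
    note d0 = y(2) z(2) 9(1) 9(3-5)
    note d = d0 d0[symmetric]
    note e = y(1) z(1) 9(2)
    have U: "P1 \<union> P2 \<union> P3 = {x, y, z, w}" using e by auto
    have n: "card (P1 \<union> P2 \<union> P3) = 4" unfolding U using d by simp
    have m: "mult3 P1 P2 P3 x = 2" "mult3 P1 P2 P3 y = 1" "mult3 P1 P2 P3 z = 2" "mult3 P1 P2 P3 w = 1"
      using d by (simp_all add: mult3_def e)
    have "F x w \<le> \<phi> 3" "F x z \<le> \<phi> 4" "F y w \<le> \<phi> 2" "F y x \<le> \<phi> 3" "F y z \<le> \<phi> 3" "F z w \<le> \<phi> 3"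
      using bound[of x w] bound[of x z] bound[of y w] bound[of y x] bound[of y z] bound[of z w] d by (simp_all add: U m eval_nat_numeral)
    then show ?thesis
      using four n d by (simp add: e pair_sum_doubletons)
  next
    case 10
    have "x \<noteq> u" "x \<noteq> v" "y \<noteq> u" "y \<noteq> v" "z \<noteq> u" "z \<noteq> v" using 10 uv(1) by auto
    note d0 = this uv(2) y(2) z(2) 10(1)
    note d = d0 d0[symmetric]
    note e = y(1) z(1) uv(1)
    have U: "P1 \<union> P2 \<union> P3 = {x, y, z, u, v}" using e by auto
    have n: "card (P1 \<union> P2 \<union> P3) = 5" unfolding U using d by simp
    have m: "mult3 P1 P2 P3 x = 2" "mult3 P1 P2 P3 y = 1" "mult3 P1 P2 P3 z = 1" "mult3 P1 P2 P3 u = 1" "mult3 P1 P2 P3 v = 1"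
      using d by (simp_all add: mult3_def e)
    have "F x u \<le> \<phi> 3" "F x v \<le> \<phi> 3" "F x z \<le> \<phi> 3" "F y u \<le> \<phi> 2" "F y v \<le> \<phi> 2" "F y x \<le> \<phi> 3" "F y z \<le> \<phi> 2" "F z u \<le> \<phi> 2" "F z v \<le> \<phi> 2"
      using bound[of x u] bound[of x v] bound[of x z] bound[of y u] bound[of y v] bound[of y x] bound[of y z] bound[of z u] bound[of z v] d by (simp_all add: U m eval_nat_numeral)
    then show ?thesis
      using four n d by (simp add: e pair_sum_doubletons)
  qed
qed

text \<open>Symmetry of \<open>F\<close> makes the total invariant under permuting the pairs, so two
  that meet can be put in front.\<close>

lemma pair_sum_overlap:
  assumes c: "card P1 = 2" "card P2 = 2" "card P3 = 2"
    and ne: "\<not> (P1 = P2 \<and> P2 = P3)" and ov: "P1 \<inter> P2 \<noteq> {} \<or> P1 \<inter> P3 \<noteq> {} \<or> P2 \<inter> P3 \<noteq> {}"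
    and sym: "\<And>x y. F x y = F y x"
    and bound: "\<And>x y. x \<in> P1 \<union> P2 \<union> P3 \<Longrightarrow> y \<in> P1 \<union> P2 \<union> P3 \<Longrightarrow> x \<noteq> y \<Longrightarrow>
      F x y \<le> \<phi> (mult3 P1 P2 P3 x + mult3 P1 P2 P3 y)"
    and three: "card (P1 \<union> P2 \<union> P3) = 3 \<Longrightarrow> 9 * \<phi> 4 \<le> K \<and> 4 * \<phi> 5 + 2 * \<phi> 4 + 2 * \<phi> 3 \<le> K"
    and four: "card (P1 \<union> P2 \<union> P3) \<ge> 4 \<Longrightarrow> \<phi> 2 + 6 * \<phi> 3 + 3 * \<phi> 4 \<le> K \<and>
      6 * \<phi> 4 + 3 * \<phi> 2 \<le> K \<and> 6 * \<phi> 3 + 5 * \<phi> 2 \<le> K \<and> 2 * \<phi> 4 + 8 * \<phi> 3 \<le> K"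
  shows "pair_sum F P1 P2 + pair_sum F P1 P3 + pair_sum F P2 P3 \<le> (K :: nat)"
proof -
  have m: "mult3 P1 P3 P2 = mult3 P1 P2 P3" "mult3 P2 P3 P1 = mult3 P1 P2 P3"
    by (auto simp: mult3_def fun_eq_iff)
  have U: "P1 \<union> P3 \<union> P2 = P1 \<union> P2 \<union> P3" "P2 \<union> P3 \<union> P1 = P1 \<union> P2 \<union> P3" by auto
  note com = pair_sum_commute[of F, OF sym]
  from ov consider "P1 \<inter> P2 \<noteq> {}" | "P1 \<inter> P3 \<noteq> {}" | "P2 \<inter> P3 \<noteq> {}" by blast
  then show ?thesis
  proof cases
    case 1
    show ?thesis by (rule pair_sum_overlap12[OF c ne 1 bound three four])
  next
    case 2
    have "pair_sum F P1 P3 + pair_sum F P1 P2 + pair_sum F P3 P2 \<le> K"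
      by (rule pair_sum_overlap12[OF c(1,3,2) _ 2, of F \<phi> K, unfolded m U, OF _ bound three four])
        (use ne in auto)
    then show ?thesis by (simp add: com[of P3 P2])
  next
    case 3
    have "pair_sum F P2 P3 + pair_sum F P2 P1 + pair_sum F P3 P1 \<le> K"
      by (rule pair_sum_overlap12[OF c(2,3,1) _ 3, of F \<phi> K, unfolded m U, OF _ bound three four])
        (use ne in auto)
    then show ?thesis by (simp add: com[of P2 P1] com[of P3 P1])
  qed
qed

text \<open>Averaging: each of the 12 terms belongs to exactly two of the 8 triples
  \<open>(x, y, z)\<close>, so twice the total is at most \<open>8 * k\<close>.\<close>

lemma pair_sum_disjoint:
  assumes c: "card P1 = 2" "card P2 = 2" "card P3 = 2"
    and dis: "P1 \<inter> P2 = {}" "P1 \<inter> P3 = {}" "P2 \<inter> P3 = {}"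
    and bound: "\<And>x y z. x \<in> P1 \<Longrightarrow> y \<in> P2 \<Longrightarrow> z \<in> P3 \<Longrightarrow> F x y + F x z + F y z \<le> k"
  shows "pair_sum F P1 P2 + pair_sum F P1 P3 + pair_sum F P2 P3 \<le> 4 * k"
proof -
  obtain a a' where a: "P1 = {a, a'}" "a \<noteq> a'" using c(1) by (auto simp: card_2_iff)
  obtain b b' where b: "P2 = {b, b'}" "b \<noteq> b'" using c(2) by (auto simp: card_2_iff)
  obtain e e' where e: "P3 = {e, e'}" "e \<noteq> e'" using c(3) by (auto simp: card_2_iff)
  have "a \<noteq> b" "a \<noteq> b'" "a' \<noteq> b" "a' \<noteq> b'" "a \<noteq> e" "a \<noteq> e'" "a' \<noteq> e" "a' \<noteq> e'"
    "b \<noteq> e" "b \<noteq> e'" "b' \<noteq> e" "b' \<noteq> e'"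
    using dis a b e by auto
  moreover have "F x y + F x z + F y z \<le> k" if "x \<in> {a, a'}" "y \<in> {b, b'}" "z \<in> {e, e'}" for x y z
    using bound[of x y z] that a b e by simp
  note this[of a b e] this[of a b e'] this[of a b' e] this[of a b' e']
    this[of a' b e] this[of a' b e'] this[of a' b' e] this[of a' b' e']
  ultimately show ?thesis
    using a(2) b(2) e(2) unfolding a(1) b(1) e(1) by (simp add: pair_sum_doubletons)
qed

text \<open>\<open>Lambda3\<close> in terms of row supports. The rows form a list because equal rows
  may occur.\<close>

definition cubic :: "'a set list \<Rightarrow> 'a set \<Rightarrow> bool" where
  "cubic Ss C \<longleftrightarrow> finite C \<and> length Ss = card C \<and> (\<forall>S\<in>set Ss. S \<subseteq> C \<and> card S = 3) \<and>
     (\<forall>x\<in>C. length (filter ((\<in>) x) Ss) = 3)"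

lemma pair_sum_Diff:
  assumes "finite P" "finite Q"
  shows "pair_sum F P Q = (\<Sum>x\<in>P. \<Sum>y\<in>Q - {x}. F x y)"
  unfolding pair_sum_def
proof (rule sum.cong[OF refl])
  fix x
  have "(\<Sum>y\<in>Q. if x = y then 0 else F x y) = (\<Sum>y\<in>Q - {x}. if x = y then 0 else F x y)"
    using assms by (intro sum.mono_neutral_right) auto
  also have "\<dots> = (\<Sum>y\<in>Q - {x}. F x y)" by (intro sum.cong) auto
  finally show "(\<Sum>y\<in>Q. if x = y then 0 else F x y) = (\<Sum>y\<in>Q - {x}. F x y)" .
qed

text \<open>The column \<open>c\<close> is used by exactly one of its three rows, and the other two pick distinct columns
  from their remaining pairs.\<close>
lemma cubic_expand_column:
  assumes cubic: "cubic Ss C" and c: "c \<in> C"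
  obtains P1 P2 P3 R where
    "mset Ss = mset (insert c P1 # insert c P2 # insert c P3 # R)"
    "P1 \<subseteq> C - {c}" "P2 \<subseteq> C - {c}" "P3 \<subseteq> C - {c}" "card P1 = 2" "card P2 = 2" "card P3 = 2"
    "\<forall>T\<in>set R. T \<subseteq> C - {c} \<and> card T = 3" "length R + 3 = card C"
    "\<forall>x\<in>C - {c}. mult3 P1 P2 P3 x + length (filter ((\<in>) x) R) = 3"
    "sdr Ss = pair_sum (\<lambda>x y. sdr (map (\<lambda>T. T - {x, y}) R)) P1 P2 +
      pair_sum (\<lambda>x y. sdr (map (\<lambda>T. T - {x, y}) R)) P1 P3 +
      pair_sum (\<lambda>x y. sdr (map (\<lambda>T. T - {x, y}) R)) P2 P3"
proof -
  have fin: "finite C" and len: "length Ss = card C"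
    and rows: "\<And>S. S \<in> set Ss \<Longrightarrow> S \<subseteq> C \<and> card S = 3"
    and cols: "\<And>x. x \<in> C \<Longrightarrow> length (filter ((\<in>) x) Ss) = 3"
    using cubic by (auto simp: cubic_def)
  define R where "R = filter (\<lambda>S. c \<notin> S) Ss"
  obtain S1 S2 S3 where S: "filter ((\<in>) c) Ss = [S1, S2, S3]"
    using cols[OF c] by (auto simp: length_Suc_conv numeral_3_eq_3)
  have ms: "mset Ss = mset (S1 # S2 # S3 # R)"
  proof -
    have "mset Ss = mset (filter ((\<in>) c) Ss) + mset R"
      unfolding R_def by simp
    then show ?thesis unfolding S by simp
  qed
  have "set (filter ((\<in>) c) Ss) = {S1, S2, S3}" unfolding S by simp
  then have inS: "S1 \<in> set Ss" "S2 \<in> set Ss" "S3 \<in> set Ss" "c \<in> S1" "c \<in> S2" "c \<in> S3" by auto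
  define P1 P2 P3 where P: "P1 = S1 - {c}" "P2 = S2 - {c}" "P3 = S3 - {c}"
  have SP: "S1 = insert c P1" "S2 = insert c P2" "S3 = insert c P3" using inS P by auto
  have sub: "P1 \<subseteq> C - {c}" "P2 \<subseteq> C - {c}" "P3 \<subseteq> C - {c}" using inS rows P by auto
  have cards: "card P1 = 2" "card P2 = 2" "card P3 = 2" using inS rows P by auto
  have finP: "finite P1" "finite P2" "finite P3" using cards by (auto intro: card_ge_0_finite)
  have R: "\<forall>T\<in>set R. T \<subseteq> C - {c} \<and> card T = 3" using rows by (auto simp: R_def)
  have lenR: "length R + 3 = card C" using mset_eq_length[OF ms] len by simp
  have mult: "mult3 P1 P2 P3 x + length (filter ((\<in>) x) R) = 3" if x: "x \<in> C - {c}" for x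
  proof -
    have "length (filter ((\<in>) x) Ss) = length (filter ((\<in>) x) (S1 # S2 # S3 # R))"
      using ms by (metis mset_eq_length mset_filter)
    then show ?thesis using cols[of x] x by (auto simp: mult3_def SP split: if_splits)
  qed
  let ?F = "\<lambda>x y. sdr (map (\<lambda>T. T - {x, y}) R)"
  let ?H = "\<lambda>x y z. sdr (map (\<lambda>T. T - {x} - {y} - {z}) R)"
  have finR: "\<forall>T\<in>set R. finite T" using R fin by (meson finite_Diff finite_subset)
  have finS: "finite S1" "finite S2" "finite S3" using SP finP by auto
  \<comment> \<open>If none of the three rows takes \<open>c\<close>, then \<open>card C - 3\<close>
    rows remain, but only \<open>card C - 4\<close> of their columns.\<close>
  have H0: "?H x y z = 0" if "{x, y, z} \<subseteq> C - {c}" "x \<noteq> y" "x \<noteq> z" "y \<noteq> z" for x y z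
  proof (rule sdr_eq_0)
    show "\<Union>(set (map (\<lambda>T. T - {x} - {y} - {z}) R)) \<subseteq> C - {c, x, y, z}" using R by auto
    have "card {c, x, y, z} = 4" "{c, x, y, z} \<subseteq> C" using that c by auto
    then have "card (C - {c, x, y, z}) = card C - 4" using fin by (simp add: card_Diff_subset)
    moreover have "card C \<ge> 4" using card_mono[OF fin \<open>{c, x, y, z} \<subseteq> C\<close>] \<open>card {c, x, y, z} = 4\<close> by simp
    ultimately show "card (C - {c, x, y, z}) < length (map (\<lambda>T. T - {x} - {y} - {z}) R)"
      using lenR by simp
  qed (use fin in simp)
  have H: "?H c y z = ?F y z" "?H y c z = ?F y z" "?H y z c = ?F y z" for y z
    by (intro arg_cong[where f = sdr] map_cong refl; use R in blast)+
  have cP: "c \<notin> P1" "c \<notin> P2" "c \<notin> P3" "S2 - {c} = P2" "\<And>y. S3 - {c} - {y} = P3 - {y}"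
    using P by auto
  have "sdr Ss = sdr (S1 # S2 # S3 # R)" by (rule sdr_mset_cong[OF ms])
  also have "\<dots> = (\<Sum>x\<in>S1. \<Sum>y\<in>S2 - {x}. \<Sum>z\<in>S3 - {x} - {y}. ?H x y z)"
    using finS finR by (simp add: sdr_Cons comp_def)
  also have "\<dots> = (\<Sum>y\<in>P2. \<Sum>z\<in>P3 - {y}. ?F y z) +
      (\<Sum>x\<in>P1. \<Sum>y\<in>S2 - {x}. \<Sum>z\<in>S3 - {x} - {y}. ?H x y z)"
    unfolding SP(1) using finP cP by (simp add: H)
  also have "(\<Sum>x\<in>P1. \<Sum>y\<in>S2 - {x}. \<Sum>z\<in>S3 - {x} - {y}. ?H x y z) =
      (\<Sum>x\<in>P1. (\<Sum>z\<in>P3 - {x}. ?F x z) + (\<Sum>y\<in>P2 - {x}. ?F x y))"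
  proof (rule sum.cong[OF refl])
    fix x assume x: "x \<in> P1"
    then have xc: "x \<noteq> c" "x \<in> C - {c}" using sub P by auto
    have S2: "S2 - {x} = insert c (P2 - {x})" "c \<notin> P2 - {x}" using xc SP P by auto
    have S3: "S3 - {x} - {c} = P3 - {x}" using P by auto
    have "(\<Sum>z\<in>S3 - {x} - {y}. ?H x y z) = ?F x y" if y: "y \<in> P2 - {x}" for y
    proof -
      have yc: "y \<noteq> c" "y \<in> C - {c}" "x \<noteq> y" using y sub P by auto
      have S3': "S3 - {x} - {y} = insert c (P3 - {x} - {y})" "c \<notin> P3 - {x} - {y}" using xc yc SP P by auto
      have "(\<Sum>z\<in>P3 - {x} - {y}. ?H x y z) = 0"
        by (intro sum.neutral ballI H0) (use xc yc sub in auto)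
      then show ?thesis unfolding S3'(1) using S3'(2) finP by (simp add: H)
    qed
    then show "(\<Sum>y\<in>S2 - {x}. \<Sum>z\<in>S3 - {x} - {y}. ?H x y z) =
        (\<Sum>z\<in>P3 - {x}. ?F x z) + (\<Sum>y\<in>P2 - {x}. ?F x y)"
      unfolding S2(1) using S2(2) finP by (simp add: S3 H)
  qed
  finally have "sdr Ss = pair_sum ?F P1 P2 + pair_sum ?F P1 P3 + pair_sum ?F P2 P3"
    using finP by (simp add: pair_sum_Diff sum.distrib)
  with that ms sub cards R lenR mult show ?thesis unfolding SP by blast
qed

text \<open>The ones of \<open>R\<close> are counted by whether they lie in column \<open>x\<close>,
  in column \<open>y\<close> or elsewhere; the additive form avoids truncated subtraction.\<close>

lemma sum_card_Diff_two:
  assumes "x \<noteq> y" "\<forall>T\<in>set R. finite T \<and> card T = k"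
  shows "sum_list (map (\<lambda>T. card (T - {x, y})) R) + length (filter ((\<in>) x) R)
    + length (filter ((\<in>) y) R) = k * length R"
  using assms(2)
proof (induction R)
  case (Cons T R)
  have "finite T" "card T = k" using Cons.prems by auto
  moreover have "T - {x, y} = T - {x} - {y}" by auto
  ultimately have "card (T - {x, y}) + of_bool (x \<in> T) + of_bool (y \<in> T) = k"
    using card_Diff_single_add[of T x] card_Diff_single_add[of "T - {x}" y] assms(1) by simp
  moreover have "length (filter ((\<in>) x) (T # R)) = of_bool (x \<in> T) + length (filter ((\<in>) x) R)"
    "length (filter ((\<in>) y) (T # R)) = of_bool (y \<in> T) + length (filter ((\<in>) y) R)"
    by simp_all
  moreover have "sum_list (map (\<lambda>T. card (T - {x, y})) (T # R)) =
      card (T - {x, y}) + sum_list (map (\<lambda>T. card (T - {x, y})) R)"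
    "k * length (T # R) = k + k * length R"
    by simp_all
  moreover have "sum_list (map (\<lambda>T. card (T - {x, y})) R) + length (filter ((\<in>) x) R)
      + length (filter ((\<in>) y) R) = k * length R"
    using Cons by simp
  ultimately show ?case by linarith
qed simp

text \<open>Deleting the column \<open>c\<close>, its rows and two further columns \<open>x\<close>, \<open>y\<close> leaves \<open>3 * (card C - 5)\<close> ones
  plus the multiplicities of \<open>x\<close> and \<open>y\<close> in \<open>P1\<close>, \<open>P2\<close>, \<open>P3\<close>.  The values of \<open>\<phi>\<close> are the resulting bounds on the
  minors.  If the three pairs are disjoint, all minors are bounded by \<open>4\<close>, which gives only \<open>48\<close>; but \<open>4\<close> requires
  each remaining row to contain exactly one of \<open>x\<close> and \<open>y\<close>, which by parity fails for one of the three
  pairs from any \<open>x \<in> P1\<close>, \<open>y \<in> P2\<close>, \<open>z \<in> P3\<close>.\<close>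
lemma cubic_triple_free_bound:
  assumes cubic: "cubic Ss C" and free: "\<And>S. count (mset Ss) S \<le> 2"
  shows "card C = 4 \<Longrightarrow> sdr Ss \<le> 9"
    and "card C = 5 \<Longrightarrow> sdr Ss \<le> 15"
    and "card C = 6 \<Longrightarrow> sdr Ss \<le> 27"
    and "card C = 7 \<Longrightarrow> sdr Ss \<le> 46"
proof -
  have fin: "finite C" using cubic by (simp add: cubic_def)
  \<comment> \<open>Each value is the largest integer whose square is at most 3 to the power
    \<open>card C\<close>.\<close>
  define K where "K = (if card C = 4 then 9 else if card C = 5 then 15 else if card C = 6 then 27 else 46 :: nat)"
  have "sdr Ss \<le> K" if n: "4 \<le> card C" "card C \<le> 7"
  proof -
    obtain c where c: "c \<in> C" using n by fastforce
    obtain P1 P2 P3 R where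
      ms: "mset Ss = mset (insert c P1 # insert c P2 # insert c P3 # R)"
      and sub: "P1 \<subseteq> C - {c}" "P2 \<subseteq> C - {c}" "P3 \<subseteq> C - {c}"
      and cards: "card P1 = 2" "card P2 = 2" "card P3 = 2"
      and R: "\<forall>T\<in>set R. T \<subseteq> C - {c} \<and> card T = 3" and lenR: "length R + 3 = card C"
      and mult: "\<forall>x\<in>C - {c}. mult3 P1 P2 P3 x + length (filter ((\<in>) x) R) = 3"
      and expand: "sdr Ss = pair_sum (\<lambda>x y. sdr (map (\<lambda>T. T - {x, y}) R)) P1 P2 +
        pair_sum (\<lambda>x y. sdr (map (\<lambda>T. T - {x, y}) R)) P1 P3 +
        pair_sum (\<lambda>x y. sdr (map (\<lambda>T. T - {x, y}) R)) P2 P3"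
      using cubic_expand_column[OF cubic c] .
    define F where "F x y = sdr (map (\<lambda>T. T - {x, y}) R)" for x y
    let ?U = "P1 \<union> P2 \<union> P3"
    let ?m = "mult3 P1 P2 P3"
    have U: "?U \<subseteq> C - {c}" using sub by auto
    have finU: "finite ?U" using U fin by (meson finite_Diff finite_subset)
    have finR: "finite T" if "T \<in> set R" for T
      using R fin that by (meson finite_Diff finite_subset)
    have sym: "F x y = F y x" for x y by (simp add: F_def insert_commute)
    have ne: "\<not> (P1 = P2 \<and> P2 = P3)"
      using free[of "insert c P1"] unfolding ms by auto
    \<comment> \<open>Degree sum 6 would put both \<open>x\<close> and \<open>y\<close> in all three
      pairs, which would then coincide.\<close>
    have m3: "?m x + ?m y \<le> 5" if "x \<noteq> y" for x y
    proof (rule ccontr)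
      assume "\<not> ?m x + ?m y \<le> 5"
      then have xy: "{x, y} \<subseteq> P1" "{x, y} \<subseteq> P2" "{x, y} \<subseteq> P3"
        by (auto simp: mult3_def of_bool_def split: if_splits)
      have "P = {x, y}" if "{x, y} \<subseteq> P" "card P = 2" for P
      proof -
        have "finite P" using that(2) by (auto intro: card_ge_0_finite)
        then show ?thesis using that \<open>x \<noteq> y\<close> card_subset_eq[of P "{x, y}"] by simp
      qed
      then show False using xy cards ne by metis
    qed
    have m1: "1 \<le> ?m x" if "x \<in> ?U" for x using that by (auto simp: mult3_def)
    have Fsub: "\<forall>T\<in>set (map (\<lambda>T. T - {x, y}) R). T \<subseteq> C - {c, x, y}" for x y
      using R by auto
    have Fcard: "card (C - {c, x, y}) + 3 = card C" if "x \<in> ?U" "y \<in> ?U" "x \<noteq> y" for x y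
    proof -
      have "x \<in> C - {c}" "y \<in> C - {c}" using that U by blast+
      then have *: "{c, x, y} \<subseteq> C" "card {c, x, y} = 3" using c that(3) by auto
      then show ?thesis using fin card_mono[OF fin *(1)] by (simp add: card_Diff_subset)
    qed
    have ones: "sum_list (map card (map (\<lambda>T. T - {x, y}) R)) + 6 = 3 * length R + (?m x + ?m y)"
      if "x \<in> ?U" "y \<in> ?U" "x \<noteq> y" for x y
    proof -
      have "?m x + length (filter ((\<in>) x) R) = 3" "?m y + length (filter ((\<in>) y) R) = 3"
        using mult that U by auto
      moreover have "sum_list (map (\<lambda>T. card (T - {x, y})) R) + length (filter ((\<in>) x) R)
          + length (filter ((\<in>) y) R) = 3 * length R"
        using sum_card_Diff_two[OF that(3), of R 3] R finR by blast
      ultimately show ?thesis by (simp add: comp_def)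
    qed
    \<comment> \<open>At most two rows remain, so every other column must have one of its three ones
      in the rows through \<open>c\<close>.\<close>
    have small: "?U = C - {c}" if "card C \<le> 5"
    proof
      show "C - {c} \<subseteq> ?U"
      proof
        fix x assume x: "x \<in> C - {c}"
        have "length (filter ((\<in>) x) R) \<le> 2"
          using length_filter_le[of "(\<in>) x" R] lenR that by linarith
        moreover have "?m x + length (filter ((\<in>) x) R) = 3" using mult x by blast
        ultimately have "?m x \<noteq> 0" by linarith
        then show "x \<in> ?U" by (auto simp: mult3_def)
      qed
    qed (rule U)
    have overlap: "P1 \<inter> P2 \<noteq> {} \<or> P1 \<inter> P3 \<noteq> {} \<or> P2 \<inter> P3 \<noteq> {}" if "card C \<le> 6"
    proof (rule ccontr)
      assume "\<not> ?thesis"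
      moreover have "finite P1" "finite P2" "finite P3" using finU by auto
      ultimately have "card ?U = 6"
        using cards by (simp add: card_Un_disjoint Int_Un_distrib2)
      moreover have "card ?U \<le> card (C - {c})" using U fin by (simp add: card_mono)
      ultimately show False using that c fin by simp
    qed
    have goal: "pair_sum F P1 P2 + pair_sum F P1 P3 + pair_sum F P2 P3 \<le> K"
      if ov: "P1 \<inter> P2 \<noteq> {} \<or> P1 \<inter> P3 \<noteq> {} \<or> P2 \<inter> P3 \<noteq> {}"
        and bound: "\<And>x y. x \<in> ?U \<Longrightarrow> y \<in> ?U \<Longrightarrow> x \<noteq> y \<Longrightarrow> F x y \<le> \<phi> (?m x + ?m y)"
        and "card ?U = 3 \<Longrightarrow> 9 * \<phi> 4 \<le> K \<and> 4 * \<phi> 5 + 2 * \<phi> 4 + 2 * \<phi> 3 \<le> K"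
        and "card ?U \<ge> 4 \<Longrightarrow> \<phi> 2 + 6 * \<phi> 3 + 3 * \<phi> 4 \<le> K \<and>
          6 * \<phi> 4 + 3 * \<phi> 2 \<le> K \<and> 6 * \<phi> 3 + 5 * \<phi> 2 \<le> K \<and> 2 * \<phi> 4 + 8 * \<phi> 3 \<le> K"
      for \<phi>
      using pair_sum_overlap[OF cards ne ov sym bound that(3,4)] .
    consider "card C = 4" | "card C = 5" | "card C = 6" | "card C = 7" using n by linarith
    then have "pair_sum F P1 P2 + pair_sum F P1 P3 + pair_sum F P2 P3 \<le> K"
    proof cases
      case 1
      have cU: "card ?U = 3" using small 1 c fin by simp
      obtain T where T: "R = [T]" using lenR 1 by (auto simp: length_Suc_conv)
      show ?thesis
      proof (rule goal[where \<phi> = "\<lambda>_. 1"])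
        fix x y assume xy: "x \<in> ?U" "y \<in> ?U" "x \<noteq> y"
        have "card (T - {x, y}) \<le> card (C - {c, x, y})"
          using Fsub[of x y] fin by (intro card_mono) (auto simp: T)
        then show "F x y \<le> 1"
          using Fcard[OF xy] 1 finR[of T] by (simp add: F_def T sdr1)
      qed (use overlap 1 cU in \<open>auto simp: K_def\<close>)
    next
      case 2
      \<comment> \<open>This rules out the triangle, whose total \<open>9 * 2 = 18\<close> would be
        too large; the star gives the maximum 15.\<close>
      have cU: "card ?U = 4" using small 2 c fin by simp
      obtain T1 T2 where T: "R = [T1, T2]" using lenR 2 by (auto simp: length_Suc_conv numeral_eq_Suc)
      show ?thesis
      proof (rule goal[where \<phi> = "\<lambda>s. if s \<le> 3 then 1 else 2"])
        fix x y assume xy: "x \<in> ?U" "y \<in> ?U" "x \<noteq> y"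
        have "card (C - {c, x, y}) = 2" using Fcard[OF xy] 2 by simp
        from sdr_2_bound[OF this, of "T1 - {x, y}" "T2 - {x, y}"]
        show "F x y \<le> (if ?m x + ?m y \<le> 3 then 1 else 2)"
          using Fsub[of x y] ones[OF xy] by (simp add: F_def T)
      qed (use overlap 2 cU in \<open>auto simp: K_def\<close>)
    next
      case 3
      obtain T1 T2 T3 where T: "R = [T1, T2, T3]"
        using lenR 3 by (auto simp: length_Suc_conv numeral_eq_Suc)
      show ?thesis
      \<comment> \<open>The values are the bounds for minors of order 3 with at most 6, 7 and 8
        ones. The triangle gives exactly \<open>9 * 3 = 27\<close>.\<close>
      proof (rule goal[where \<phi> = "\<lambda>s. if s \<le> 3 then 2 else if s \<le> 4 then 3 else 4"])
        fix x y assume xy: "x \<in> ?U" "y \<in> ?U" "x \<noteq> y"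
        have D: "card (C - {c, x, y}) = 3" using Fcard[OF xy] 3 by simp
        then obtain p q r where pqr: "C - {c, x, y} = {p, q, r}" by (auto simp: card_3_iff)
        show "F x y \<le> (if ?m x + ?m y \<le> 3 then 2 else if ?m x + ?m y \<le> 4 then 3 else 4)"
          using sdr_3_bounds(1-3)[OF pqr D, of "T1 - {x, y}" "T2 - {x, y}" "T3 - {x, y}"]
            Fsub[of x y] ones[OF xy] m3[OF xy(3)] by (simp add: F_def T)
      qed (use overlap 3 in \<open>auto simp: K_def\<close>)
    next
      case 4
      have lR: "length R = 4" using lenR 4 by simp
      have b4: "(s = 2 \<longrightarrow> F x y \<le> 4) \<and> (s = 3 \<longrightarrow> F x y \<le> 4) \<and> (s = 4 \<longrightarrow> F x y \<le> 5) \<and> (s = 5 \<longrightarrow> F x y \<le> 6) \<and>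
          (s = 2 \<longrightarrow> (\<exists>T\<in>set R. card (T - {x, y}) \<noteq> 2) \<longrightarrow> F x y \<le> 3)"
        if xy: "x \<in> ?U" "y \<in> ?U" "x \<noteq> y" and s: "s = ?m x + ?m y" for x y s
      proof -
        have D: "card (C - {c, x, y}) = 4" using Fcard[OF xy] 4 by simp
        have le3: "\<forall>T\<in>set (map (\<lambda>T. T - {x, y}) R). card T \<le> 3"
        proof clarsimp
          fix T assume "T \<in> set R"
          then show "card (T - {x, y}) \<le> 3" using R finR[of T] card_mono[of T "T - {x, y}"] by auto
        qed
        \<comment> \<open>A row that still has three elements after deleting \<open>x\<close> and
          \<open>y\<close> contained neither, so equal such rows in the minor were equal
          before.\<close>
        have cnt: "count (mset (map (\<lambda>T. T - {x, y}) R)) S \<le> 2" if S: "card S = 3" for S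
        proof -
          have "T = S" if "T \<in> set R" "T - {x, y} = S" for T
            using that R finR[of T] S card_subset_eq[of T S] by auto
          then have "length (filter (\<lambda>T. T - {x, y} = S) R) \<le> length (filter (\<lambda>T. T = S) R)"
            by (induction R) auto
          moreover have "count (mset (map f R)) S = length (filter (\<lambda>T. f T = S) R)" for f
            by (induction R) auto
          moreover have "length (filter (\<lambda>T. T = S) R) = count (mset R) S" by (induction R) auto
          moreover have "count (mset R) S \<le> count (mset Ss) S" unfolding ms by simp
          ultimately show ?thesis using free[of S] by simp
        qed
        have "sum_list (map card (map (\<lambda>T. T - {x, y}) R)) = 6 + s"
          using ones[OF xy] lR s by simp
        then show ?thesis
          using sdr_4_bounds[OF D _ Fsub le3 cnt] lR by (auto simp: F_def)
      qed
      show ?thesis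
      proof (cases "P1 \<inter> P2 \<noteq> {} \<or> P1 \<inter> P3 \<noteq> {} \<or> P2 \<inter> P3 \<noteq> {}")
        case True
        show ?thesis
        \<comment> \<open>The values are the bounds for minors of order 4 with 8 to 11 ones. The
          largest total is 45, from the triangle.\<close>
        proof (rule goal[OF True, where \<phi> = "\<lambda>s. if s \<le> 3 then 4 else if s \<le> 4 then 5 else 6"])
          fix x y assume xy: "x \<in> ?U" "y \<in> ?U" "x \<noteq> y"
          have "?m x + ?m y = 2 \<or> ?m x + ?m y = 3 \<or> ?m x + ?m y = 4 \<or> ?m x + ?m y = 5"
            using m3[OF xy(3)] m1[OF xy(1)] m1[OF xy(2)] by linarith
          then show "F x y \<le> (if ?m x + ?m y \<le> 3 then 4 else if ?m x + ?m y \<le> 4 then 5 else 6)"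
            using b4[OF xy refl] by (elim disjE) simp_all
        qed (use 4 in \<open>auto simp: K_def\<close>)
      next
        case False
        then have dis: "P1 \<inter> P2 = {}" "P1 \<inter> P3 = {}" "P2 \<inter> P3 = {}" by auto
        then have m: "?m x = 1" if "x \<in> ?U" for x
          using that by (auto simp: mult3_def)
        have "pair_sum F P1 P2 + pair_sum F P1 P3 + pair_sum F P2 P3 \<le> 4 * 11"
        proof (rule pair_sum_disjoint[OF cards dis])
          fix x y z assume xyz: "x \<in> P1" "y \<in> P2" "z \<in> P3"
          then have "x \<noteq> y" "x \<noteq> z" "y \<noteq> z" using dis by auto
          then have b: "F u v \<le> 4 \<and> ((\<exists>T\<in>set R. card (T - {u, v}) \<noteq> 2) \<longrightarrow> F u v \<le> 3)"
            if "(u, v) \<in> {(x, y), (x, z), (y, z)}" for u v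
            using b4[of u v 2] m[of u] m[of v] that xyz by auto
          show "F x y + F x z + F y z \<le> 11"
          proof (rule ccontr)
            assume big: "\<not> F x y + F x z + F y z \<le> 11"
            have bb: "F x y \<le> 4" "F x z \<le> 4" "F y z \<le> 4" using b by auto
            obtain T where T: "T \<in> set R" using lR by (cases R) auto
            have T3: "finite T" "card T = 3" using R finR T by auto
            have two: "card (T - {u, v}) = 2" if "(u, v) \<in> {(x, y), (x, z), (y, z)}" for u v
              using b[OF that] that T bb big by auto
            have "of_bool (u \<in> T) + of_bool (v \<in> T) = (1 :: nat)"
              if "(u, v) \<in> {(x, y), (x, z), (y, z)}" for u v
            proof -
              have "u \<noteq> v" using that \<open>x \<noteq> y\<close> \<open>x \<noteq> z\<close> \<open>y \<noteq> z\<close> by auto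
              moreover have "T - {u, v} = T - {u} - {v}" by auto
              ultimately show ?thesis
                using two[OF that] T3 card_Diff_single_add[of T u] card_Diff_single_add[of "T - {u}" v]
                by simp
            qed
            from this[of x y] this[of x z] this[of y z] show False
              by (cases "x \<in> T"; cases "y \<in> T"; cases "z \<in> T") simp_all
          qed
        qed
        then show ?thesis using 4 by (simp add: K_def)
      qed
    qed
    then show ?thesis unfolding expand F_def .
  qed
  then show "card C = 4 \<Longrightarrow> sdr Ss \<le> 9" "card C = 5 \<Longrightarrow> sdr Ss \<le> 15"
    "card C = 6 \<Longrightarrow> sdr Ss \<le> 27" "card C = 7 \<Longrightarrow> sdr Ss \<le> 46"
    by (auto simp: K_def)
qed

section \<open>Decomposition of matrices\<close>

definition col_supp :: "nat mat \<Rightarrow> nat \<Rightarrow> nat set" where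
  "col_supp A j = {i. i < dim_row A \<and> A $$ (i, j) = 1}"

lemma Lambda3_iff_supp:
  "A \<in> Lambda3 n \<longleftrightarrow> A \<in> carrier_mat n n \<and> (\<forall>i<n. \<forall>j<n. A $$ (i, j) \<in> {0, 1}) \<and>
    (\<forall>i<n. card (row_supp A i) = 3) \<and> (\<forall>j<n. card (col_supp A j) = 3)"
  by (auto simp: Lambda3_def row_supp_def col_supp_def)

lemma permanent_Lambda3:
  assumes "A \<in> Lambda3 n"
  shows "permanent A = sdr (map (row_supp A) [0..<n])"
  using assms by (intro permanent_eq_sdr) (auto simp: Lambda3_def)

lemma row_supp_subset: "A \<in> Lambda3 n \<Longrightarrow> row_supp A i \<subseteq> {0..<n}"
  by (auto simp: Lambda3_def row_supp_def)

lemma col_supp_subset: "A \<in> Lambda3 n \<Longrightarrow> col_supp A j \<subseteq> {0..<n}"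
  by (auto simp: Lambda3_def col_supp_def)

lemma length_filter_map_upt: "length (filter P (map f [0..<n])) = card {i. i < n \<and> P (f i)}"
  by (simp add: distinct_length_filter comp_def) (auto intro: arg_cong[where f = card])

lemma cubic_Lambda3:
  assumes "A \<in> Lambda3 n"
  shows "cubic (map (row_supp A) [0..<n]) {0..<n}"
proof -
  have "{i. i < n \<and> x \<in> row_supp A i} = col_supp A x" if "x < n" for x
    using assms that by (auto simp: Lambda3_def row_supp_def col_supp_def)
  then have "length (filter ((\<in>) x) (map (row_supp A) [0..<n])) = 3" if "x < n" for x
    using assms that unfolding length_filter_map_upt by (simp add: Lambda3_iff_supp)
  moreover have "card (row_supp A i) = 3" if "i < n" for i
    using assms that by (simp add: Lambda3_iff_supp)
  ultimately show ?thesis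
    using row_supp_subset[OF assms] unfolding cubic_def by (auto simp del: filter_map)
qed

section \<open>Submatrices as closed pairs of row and column sets\<close>

lemma bij_betw_pick:
  assumes "finite I"
  shows "bij_betw (pick I) {0..<card I} I"
proof -
  have inj: "inj_on (pick I) {0..<card I}"
    using pick_mono[of _ I] by (intro linorder_inj_onI) (auto, metis less_irrefl)
  have "pick I ` {0..<card I} \<subseteq> I" using pick_in_set[of _ I] by auto
  moreover have "card (pick I ` {0..<card I}) = card I" using card_image[OF inj] by simp
  ultimately have "pick I ` {0..<card I} = I" using assms by (intro card_subset_eq)
  with inj show ?thesis by (auto simp: bij_betw_def)
qed

context
  fixes A :: "nat mat" and n :: nat and I J :: "nat set"
  assumes A: "A \<in> Lambda3 n" and I: "I \<subseteq> {0..<n}" and J: "J \<subseteq> {0..<n}"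
begin

lemma dim_submatrix_Lambda3:
  "dim_row (submatrix A I J) = card I" "dim_col (submatrix A I J) = card J"
proof -
  have "{i. i < n \<and> i \<in> I} = I" "{i. i < n \<and> i \<in> J} = J" using I J by auto
  moreover have "dim_row A = n" "dim_col A = n" using A by (auto simp: Lambda3_def)
  ultimately show "dim_row (submatrix A I J) = card I" "dim_col (submatrix A I J) = card J"
    by (simp_all add: dim_submatrix)
qed

lemma submatrix_Lambda3_index:
  assumes "i < card I" "j < card J"
  shows "submatrix A I J $$ (i, j) = A $$ (pick I i, pick J j)"
  using assms dim_submatrix_Lambda3 by (intro submatrix_index) (simp_all add: dim_submatrix)

lemma finite_I_J: "finite I" "finite J"
  using I J by (auto intro: finite_subset)

lemma pick_row_supp_submatrix:
  assumes "i < card I"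
  shows "pick J ` row_supp (submatrix A I J) i = row_supp A (pick I i) \<inter> J"
proof -
  have dimA: "dim_col A = n" using A by (auto simp: Lambda3_def)
  have J': "pick J ` {0..<card J} = J" using bij_betw_pick[OF finite_I_J(2)] by (simp add: bij_betw_def)
  have "row_supp (submatrix A I J) i = {j \<in> {0..<card J}. A $$ (pick I i, pick J j) = 1}"
    using assms by (auto simp: row_supp_def dim_submatrix_Lambda3 submatrix_Lambda3_index)
  moreover have "row_supp A (pick I i) \<inter> J = {j \<in> J. A $$ (pick I i, j) = 1}"
    using J by (auto simp: row_supp_def dimA)
  moreover have "pick J ` {j \<in> {0..<card J}. A $$ (pick I i, pick J j) = 1} =
      {j \<in> pick J ` {0..<card J}. A $$ (pick I i, j) = 1}"
    by auto
  ultimately show ?thesis unfolding J' by simp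
qed

lemma pick_col_supp_submatrix:
  assumes "j < card J"
  shows "pick I ` col_supp (submatrix A I J) j = col_supp A (pick J j) \<inter> I"
proof -
  have dimA: "dim_row A = n" using A by (auto simp: Lambda3_def)
  have I': "pick I ` {0..<card I} = I" using bij_betw_pick[OF finite_I_J(1)] by (simp add: bij_betw_def)
  have "col_supp (submatrix A I J) j = {i \<in> {0..<card I}. A $$ (pick I i, pick J j) = 1}"
    using assms by (auto simp: col_supp_def dim_submatrix_Lambda3 submatrix_Lambda3_index)
  moreover have "col_supp A (pick J j) \<inter> I = {i \<in> I. A $$ (i, pick J j) = 1}"
    using I by (auto simp: col_supp_def dimA)
  moreover have "pick I ` {i \<in> {0..<card I}. A $$ (pick I i, pick J j) = 1} =
      {i \<in> pick I ` {0..<card I}. A $$ (i, pick J j) = 1}"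
    by auto
  ultimately show ?thesis unfolding I' by simp
qed

lemma card_supp_submatrix:
  "i < card I \<Longrightarrow> card (row_supp (submatrix A I J) i) = card (row_supp A (pick I i) \<inter> J)"
  "j < card J \<Longrightarrow> card (col_supp (submatrix A I J) j) = card (col_supp A (pick J j) \<inter> I)"
proof -
  show "card (row_supp (submatrix A I J) i) = card (row_supp A (pick I i) \<inter> J)" if "i < card I"
  proof -
    have "inj_on (pick J) (row_supp (submatrix A I J) i)"
      using bij_betw_pick[OF finite_I_J(2)]
      by (auto simp: bij_betw_def row_supp_def dim_submatrix_Lambda3 intro: inj_on_subset)
    then show ?thesis using card_image pick_row_supp_submatrix[OF that] by metis
  qed
  show "card (col_supp (submatrix A I J) j) = card (col_supp A (pick J j) \<inter> I)" if "j < card J"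
  proof -
    have "inj_on (pick I) (col_supp (submatrix A I J) j)"
      using bij_betw_pick[OF finite_I_J(1)]
      by (auto simp: bij_betw_def col_supp_def dim_submatrix_Lambda3 intro: inj_on_subset)
    then show ?thesis using card_image pick_col_supp_submatrix[OF that] by metis
  qed
qed

text \<open>Every line of \<open>A\<close> has only three ones, so a line of the submatrix has three
  ones exactly if none is cut off. Hence \<open>I\<close> and \<open>J\<close> together form a union
  of connected components of the bipartite graph of \<open>A\<close>.\<close>

lemma submatrix_in_Lambda3_iff:
  "submatrix A I J \<in> Lambda3 m \<longleftrightarrow> card I = m \<and> card J = m \<and>
    (\<forall>i\<in>I. row_supp A i \<subseteq> J) \<and> (\<forall>j\<in>J. col_supp A j \<subseteq> I)"
proof -
  have finA: "finite (row_supp A i)" "finite (col_supp A i)" for i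
    using finite_subset[OF row_supp_subset[OF A]] finite_subset[OF col_supp_subset[OF A]] by auto
  have I': "I = pick I ` {0..<card I}" and J': "J = pick J ` {0..<card J}"
    using bij_betw_pick[OF finite_I_J(1)] bij_betw_pick[OF finite_I_J(2)] by (auto simp: bij_betw_def)
  have pI: "pick I i < n" if "i < card I" for i using pick_in_set[of i I] that I by auto
  have pJ: "pick J j < n" if "j < card J" for j using pick_in_set[of j J] that J by auto
  have r: "card (row_supp A (pick I i) \<inter> J) = 3 \<longleftrightarrow> row_supp A (pick I i) \<subseteq> J" if "i < card I" for i
  proof -
    have c: "card (row_supp A (pick I i)) = 3" using A pI[OF that] by (simp add: Lambda3_iff_supp)
    show ?thesis
    proof
      assume "card (row_supp A (pick I i) \<inter> J) = 3"
      then have "row_supp A (pick I i) \<inter> J = row_supp A (pick I i)"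
        using c finA by (intro card_subset_eq) auto
      then show "row_supp A (pick I i) \<subseteq> J" by blast
    qed (use c in \<open>simp add: Int_absorb2\<close>)
  qed
  have k: "card (col_supp A (pick J j) \<inter> I) = 3 \<longleftrightarrow> col_supp A (pick J j) \<subseteq> I" if "j < card J" for j
  proof -
    have c: "card (col_supp A (pick J j)) = 3" using A pJ[OF that] by (simp add: Lambda3_iff_supp)
    show ?thesis
    proof
      assume "card (col_supp A (pick J j) \<inter> I) = 3"
      then have "col_supp A (pick J j) \<inter> I = col_supp A (pick J j)"
        using c finA by (intro card_subset_eq) auto
      then show "col_supp A (pick J j) \<subseteq> I" by blast
    qed (use c in \<open>simp add: Int_absorb2\<close>)
  qed
  have carrier: "submatrix A I J \<in> carrier_mat m m \<longleftrightarrow> card I = m \<and> card J = m"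
    unfolding carrier_mat_def mem_Collect_eq dim_submatrix_Lambda3 ..
  have ent: "submatrix A I J $$ (i, j) \<in> {0, 1}" if "i < card I" "j < card J" for i j
    using A pI[OF that(1)] pJ[OF that(2)] unfolding submatrix_Lambda3_index[OF that] Lambda3_iff_supp by blast
  have "(\<forall>i\<in>pick I ` {0..<card I}. row_supp A i \<subseteq> J) \<longleftrightarrow> (\<forall>i<card I. row_supp A (pick I i) \<subseteq> J)"
    by auto
  then have rows: "(\<forall>i\<in>I. row_supp A i \<subseteq> J) \<longleftrightarrow> (\<forall>i<card I. row_supp A (pick I i) \<subseteq> J)"
    unfolding I'[symmetric] .
  have "(\<forall>j\<in>pick J ` {0..<card J}. col_supp A j \<subseteq> I) \<longleftrightarrow> (\<forall>j<card J. col_supp A (pick J j) \<subseteq> I)"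
    by auto
  then have cols: "(\<forall>j\<in>J. col_supp A j \<subseteq> I) \<longleftrightarrow> (\<forall>j<card J. col_supp A (pick J j) \<subseteq> I)"
    unfolding J'[symmetric] .
  show ?thesis
  proof (cases "card I = m \<and> card J = m")
    case True
    then have m: "card I = m" "card J = m" by auto
    have "\<forall>i<m. \<forall>j<m. submatrix A I J $$ (i, j) \<in> {0, 1}" using ent m by simp
    moreover have "card (row_supp (submatrix A I J) i) = 3 \<longleftrightarrow> row_supp A (pick I i) \<subseteq> J" if "i < m" for i
      using card_supp_submatrix(1)[of i] r[of i] m that by simp
    moreover have "card (col_supp (submatrix A I J) j) = 3 \<longleftrightarrow> col_supp A (pick J j) \<subseteq> I" if "j < m" for j
      using card_supp_submatrix(2)[of j] k[of j] m that by simp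
    ultimately show ?thesis
      unfolding Lambda3_iff_supp carrier rows cols m by simp
  next
    case False
    then show ?thesis unfolding Lambda3_iff_supp carrier by blast
  qed
qed

text \<open>No selected row loses a one, so the submatrix has the rows of \<open>A\<close> with
  columns renamed by \<open>pick J\<close>.\<close>

lemma permanent_submatrix:
  assumes "submatrix A I J \<in> Lambda3 m"
  shows "permanent (submatrix A I J) = sdr (map (row_supp A) (map (pick I) [0..<m]))"
proof -
  have m: "card I = m" "card J = m" and cl: "\<forall>i\<in>I. row_supp A i \<subseteq> J"
    using assms by (auto simp: submatrix_in_Lambda3_iff)
  have "map (image (pick J)) (map (row_supp (submatrix A I J)) [0..<m]) =
      map (row_supp A) (map (pick I) [0..<m])"
    using pick_row_supp_submatrix pick_in_set[of _ I] cl m by (auto simp: Int_absorb2)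
  moreover have "inj_on (pick J) (\<Union>(set (map (row_supp (submatrix A I J)) [0..<m])))"
    using bij_betw_pick[OF finite_I_J(2)] m
    by (auto simp: bij_betw_def row_supp_def dim_submatrix_Lambda3 intro: inj_on_subset)
  ultimately show ?thesis
    using permanent_Lambda3[OF assms] sdr_image by metis
qed

end

text \<open>The complement of a closed pair is closed too, so \<open>A\<close> is a direct sum up to
  reordering rows and columns; the permanent factors because the two groups of rows use disjoint
  columns.\<close>

lemma Lambda3_split:
  assumes A: "A \<in> Lambda3 n" and I: "I \<subseteq> {0..<n}" and J: "J \<subseteq> {0..<n}"
    and sub: "submatrix A I J \<in> Lambda3 m"
  obtains B where "B \<in> Lambda3 (n - m)" "permanent A = permanent (submatrix A I J) * permanent B"
proof -
  let ?I = "{0..<n} - I" and ?J = "{0..<n} - J"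
  have I': "?I \<subseteq> {0..<n}" and J': "?J \<subseteq> {0..<n}" by auto
  have m: "card I = m" "card J = m" and cl: "\<forall>i\<in>I. row_supp A i \<subseteq> J" "\<forall>j\<in>J. col_supp A j \<subseteq> I"
    using sub by (auto simp: submatrix_in_Lambda3_iff[OF A I J])
  have fin: "finite I" "finite J" using I J by (auto intro: finite_subset)
  have sym: "j \<in> row_supp A i \<longleftrightarrow> i \<in> col_supp A j" if "i < n" "j < n" for i j
    using A that by (auto simp: Lambda3_def row_supp_def col_supp_def)
  have cl': "\<forall>i\<in>?I. row_supp A i \<subseteq> ?J"
  proof (intro ballI subsetI)
    fix i j assume ij: "i \<in> ?I" "j \<in> row_supp A i"
    then have "j < n" using row_supp_subset[OF A, of i] by auto
    then show "j \<in> ?J" using ij cl(2) sym[of i j] by auto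
  qed
  have "\<forall>j\<in>?J. col_supp A j \<subseteq> ?I"
  proof (intro ballI subsetI)
    fix i j assume ij: "j \<in> ?J" "i \<in> col_supp A j"
    then have "i < n" using col_supp_subset[OF A, of j] by auto
    then show "i \<in> ?I" using ij cl(1) sym[of i j] by auto
  qed
  with cl' have B: "submatrix A ?I ?J \<in> Lambda3 (n - m)"
    using m fin I J by (simp add: submatrix_in_Lambda3_iff[OF A I' J'] card_Diff_subset)
  have mn: "m \<le> n" using m card_mono[OF _ I] by simp
  have cI: "card ?I = n - m" using m fin I by (simp add: card_Diff_subset)
  have b1: "bij_betw (pick I) {0..<m} I" and b2: "bij_betw (pick ?I) {0..<n - m} ?I"
    using bij_betw_pick[of I] bij_betw_pick[of ?I] fin m cI by auto
  let ?xs = "map (pick I) [0..<m]" and ?ys = "map (pick ?I) [0..<n - m]"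
  have "distinct (?xs @ ?ys)" "set (?xs @ ?ys) = set [0..<n]"
    using b1 b2 I by (auto simp: distinct_map bij_betw_def)
  then have "mset (?xs @ ?ys) = mset [0..<n]"
    using set_eq_iff_mset_eq_distinct[of "?xs @ ?ys" "[0..<n]"] by simp
  then have "mset (map (row_supp A) [0..<n]) = mset (map (row_supp A) ?xs @ map (row_supp A) ?ys)"
    by (metis map_append mset_map)
  then have "permanent A = sdr (map (row_supp A) ?xs @ map (row_supp A) ?ys)"
    using permanent_Lambda3[OF A] sdr_mset_cong by metis
  also have "\<dots> = sdr (map (row_supp A) ?xs) * sdr (map (row_supp A) ?ys)"
  proof (rule sdr_append)
    have "set ?xs = I" "set ?ys = ?I" using b1 b2 by (auto simp: bij_betw_def)
    then show "\<Union>(set (map (row_supp A) ?xs)) \<inter> \<Union>(set (map (row_supp A) ?ys)) = {}"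
      using cl(1) cl' unfolding set_map by blast
  qed
  also have "\<dots> = permanent (submatrix A I J) * permanent (submatrix A ?I ?J)"
    using permanent_submatrix[OF A I J sub] permanent_submatrix[OF A I' J' B] by simp
  finally show ?thesis using that B by blast
qed

section \<open>Bounds for completely indecomposable matrices\<close>

lemma sdr_le_power:
  assumes "finite C" "\<Union>(set Ss) \<subseteq> C"
  shows "sdr Ss \<le> card C ^ length Ss"
proof -
  have "{xs. distinct xs \<and> list_all2 (\<in>) xs Ss} \<subseteq> {xs. set xs \<subseteq> C \<and> length xs = length Ss}"
    using assms(2) list_all2_set_subset list_all2_lengthD by blast
  then have "sdr Ss \<le> card {xs. set xs \<subseteq> C \<and> length xs = length Ss}"
    unfolding sdr_def using assms(1) by (intro card_mono finite_lists_length_eq)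
  then show ?thesis using assms(1) by (simp add: card_lists_length_eq)
qed

lemma indec_Lambda3_subset: "indec_Lambda3 s \<subseteq> Lambda3 s"
  by (auto simp: indec_Lambda3_def)

text \<open>The crude bound \<open>s ^ s\<close> is only there to make the \<open>Max\<close> in
  \<open>mu1\<close> an upper bound.\<close>

lemma finite_ps_indec: "finite (ps (indec_Lambda3 s))"
proof -
  have "permanent A \<le> s ^ s" if "A \<in> indec_Lambda3 s" for A
  proof -
    have A: "A \<in> Lambda3 s" using that indec_Lambda3_subset by auto
    have "\<Union>(set (map (row_supp A) [0..<s])) \<subseteq> {0..<s}"
      by (simp add: UN_subset_iff row_supp_subset[OF A])
    from sdr_le_power[OF _ this] show ?thesis by (simp add: permanent_Lambda3[OF A])
  qed
  then have "ps (indec_Lambda3 s) \<subseteq> {..s ^ s}" by (auto simp: ps_def)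
  then show ?thesis by (rule finite_subset) simp
qed

lemma ps_indec_le_mu1: "x \<in> ps (indec_Lambda3 s) \<Longrightarrow> x \<le> mu1 s"
  unfolding mu1_def by (rule Max_ge[OF finite_ps_indec])

text \<open>Three equal rows exhaust the ones of their three columns and so form a closed block of
  order 3, which is proper for \<open>s > 3\<close>.\<close>

lemma indec_triple_free:
  assumes A: "A \<in> indec_Lambda3 s" and s: "s > 3"
  shows "count (mset (map (row_supp A) [0..<s])) S \<le> 2"
proof (rule ccontr)
  assume "\<not> count (mset (map (row_supp A) [0..<s])) S \<le> 2"
  define I where "I = {i. i < s \<and> row_supp A i = S}"
  have A': "A \<in> Lambda3 s" using A indec_Lambda3_subset by auto
  have "count (mset (map f [0..<s])) S = card {i. i < s \<and> f i = S}" for f :: "nat \<Rightarrow> nat set"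
    unfolding count_mset count_list_eq_length_filter length_filter_map_upt by (simp add: eq_commute)
  then have cI: "card I > 2"
    using \<open>\<not> _\<close> unfolding I_def by simp
  then obtain i where i: "i \<in> I" by (metis card.empty ex_in_conv not_less_zero)
  then have S: "S \<subseteq> {0..<s}" "card S = 3"
    using A' row_supp_subset[OF A', of i] by (auto simp: I_def Lambda3_iff_supp)
  have I: "I \<subseteq> {0..<s}" by (auto simp: I_def)
  have finI: "finite I" using I by (rule finite_subset) simp
  have col: "col_supp A j = I" if "j \<in> S" for j
  proof -
    have "I \<subseteq> col_supp A j"
      using that A' by (auto simp: I_def row_supp_def col_supp_def Lambda3_def)
    moreover have "card (col_supp A j) = 3" using A' that S by (auto simp: Lambda3_iff_supp)
    moreover have "finite (col_supp A j)" using finite_subset[OF col_supp_subset[OF A']] by auto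
    ultimately show ?thesis using cI by (metis card_subset_eq card_mono le_antisym
      Suc_leI eval_nat_numeral(3))
  qed
  obtain j where "j \<in> S" using S(2) by fastforce
  then have "card I = 3" using col[of j] A' S by (auto simp: Lambda3_iff_supp)
  then have "submatrix A I S \<in> Lambda3 3"
    unfolding submatrix_in_Lambda3_iff[OF A' I S(1)] using S(2) col by (auto simp: I_def)
  then show False
    using A s I S(1) unfolding indec_Lambda3_def by fastforce
qed

lemma permanent_indec_bounds:
  assumes "A \<in> indec_Lambda3 s"
  shows "s = 4 \<Longrightarrow> permanent A \<le> 9" "s = 5 \<Longrightarrow> permanent A \<le> 15"
    "s = 6 \<Longrightarrow> permanent A \<le> 27" "s = 7 \<Longrightarrow> permanent A \<le> 46"
proof -
  have A: "A \<in> Lambda3 s" using assms indec_Lambda3_subset by auto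
  note b = cubic_triple_free_bound[OF cubic_Lambda3[OF A] indec_triple_free[OF assms]]
  show "s = 4 \<Longrightarrow> permanent A \<le> 9" "s = 5 \<Longrightarrow> permanent A \<le> 15"
    "s = 6 \<Longrightarrow> permanent A \<le> 27" "s = 7 \<Longrightarrow> permanent A \<le> 46"
    using b by (simp_all add: permanent_Lambda3[OF A])
qed

section \<open>Existence of completely indecomposable matrices\<close>

text \<open>Needed since \<^const>\<open>mu1\<close> is a junk value if there is no indecomposable matrix.\<close>
definition circ3 :: "nat \<Rightarrow> nat mat" where
  "circ3 s = mat s s (\<lambda>(i, j). of_bool (j = i \<or> j = i + 1 \<or> j = i + 2 \<or> j + s = i + 1 \<or> j + s = i + 2))"

text \<open>The wrap-around is written as \<open>j + s = i + 1\<close> and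
  \<open>j + s = i + 2\<close> instead of with \<open>mod\<close>, so that all supports can be
  identified by linear arithmetic.\<close>

lemma circ3_in_Lambda3:
  assumes "s \<ge> 3"
  shows "circ3 s \<in> Lambda3 s"
proof -
  have ent: "circ3 s $$ (i, j) = 1 \<longleftrightarrow> (j = i \<or> j = i + 1 \<or> j = i + 2 \<or> j + s = i + 1 \<or> j + s = i + 2)"
    if "i < s" "j < s" for i j
    unfolding circ3_def index_mat(1)[OF that] prod.case of_bool_eq_1_iff ..
  have dim: "dim_row (circ3 s) = s" "dim_col (circ3 s) = s" by (simp_all add: circ3_def)
  have row: "j \<in> row_supp (circ3 s) i \<longleftrightarrow>
      j < s \<and> (j = i \<or> j = i + 1 \<or> j = i + 2 \<or> j + s = i + 1 \<or> j + s = i + 2)" if "i < s" for i j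
    unfolding row_supp_def mem_Collect_eq dim using ent[OF that] by blast
  have col: "i \<in> col_supp (circ3 s) j \<longleftrightarrow>
      i < s \<and> (j = i \<or> j = i + 1 \<or> j = i + 2 \<or> j + s = i + 1 \<or> j + s = i + 2)" if "j < s" for i j
    unfolding col_supp_def mem_Collect_eq dim using ent[OF _ that] by blast
  have "card (row_supp (circ3 s) i) = 3" if i: "i < s" for i
  proof -
    consider "i + 2 < s" | "i + 2 = s" | "i + 1 = s" using i by linarith
    then show ?thesis
    proof cases
      case 1
      then have "row_supp (circ3 s) i = {i, i + 1, i + 2}"
        unfolding set_eq_iff row[OF i] insert_iff empty_iff by presburger
      then show ?thesis by simp
    next
      case 2
      then have "row_supp (circ3 s) i = {i, i + 1, 0}"
        unfolding set_eq_iff row[OF i] insert_iff empty_iff using assms by presburger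
      then show ?thesis using 2 assms by simp
    next
      case 3
      then have "row_supp (circ3 s) i = {i, 0, 1}"
        unfolding set_eq_iff row[OF i] insert_iff empty_iff using assms by presburger
      then show ?thesis using 3 assms by simp
    qed
  qed
  moreover have "card (col_supp (circ3 s) j) = 3" if j: "j < s" for j
  proof -
    obtain q where q: "s = q + 3" using assms by (metis add.commute le_Suc_ex)
    consider k where "j = k + 2" | "j = 1" | "j = 0"
      by (metis One_nat_def add_2_eq_Suc' not0_implies_Suc)
    then show ?thesis
    proof cases
      case (1 k)
      then have "col_supp (circ3 s) j = {k + 2, k + 1, k}"
        unfolding set_eq_iff col[OF j] insert_iff empty_iff using j by presburger
      then show ?thesis by simp
    next
      case 2
      then have "col_supp (circ3 s) j = {1, 0, q + 2}"
        unfolding set_eq_iff col[OF j] insert_iff empty_iff using q by presburger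
      then show ?thesis by simp
    next
      case 3
      then have "col_supp (circ3 s) j = {0, q + 2, q + 1}"
        unfolding set_eq_iff col[OF j] insert_iff empty_iff using q by presburger
      then show ?thesis by simp
    qed
  qed
  moreover have "circ3 s \<in> carrier_mat s s" by (simp add: circ3_def)
  moreover have "\<forall>i<s. \<forall>j<s. circ3 s $$ (i, j) \<in> {0, 1}" by (simp add: circ3_def)
  ultimately show ?thesis unfolding Lambda3_iff_supp by blast
qed

text \<open>A closed pair containing row \<open>i\<close> contains column \<open>i + 1\<close>
  (cyclically) and, through the diagonal entry of that column, row \<open>i + 1\<close>. Thus a
  nonempty closed pair contains all rows.\<close>

lemma circ3_indec:
  assumes s: "s \<ge> 3"
  shows "circ3 s \<in> indec_Lambda3 s"
proof -
  let ?A = "circ3 s"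
  note A = circ3_in_Lambda3[OF s]
  have False if mIJ: "0 < m" "m < s" "I \<subseteq> {0..<s}" "J \<subseteq> {0..<s}" "submatrix ?A I J \<in> Lambda3 m" for m I J
  proof -
    have cl: "card I = m" "\<forall>i\<in>I. row_supp ?A i \<subseteq> J" "\<forall>j\<in>J. col_supp ?A j \<subseteq> I"
      using mIJ by (auto simp: submatrix_in_Lambda3_iff[OF A mIJ(3,4)])
    have step: "(if i + 1 < s then i + 1 else 0) \<in> I" if i: "i \<in> I" for i
    proof -
      let ?j = "if i + 1 < s then i + 1 else 0"
      have "i < s" using i mIJ by auto
      then have "?j \<in> row_supp ?A i" "?j \<in> col_supp ?A ?j"
        using s by (auto simp: row_supp_def col_supp_def circ3_def)
      then show ?thesis using cl i by blast
    qed
    have up: "i + k \<in> I" if "i \<in> I" "i + k < s" for i k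
      using that(2)
    proof (induction k)
      case (Suc k)
      then show ?case using step[of "i + k"] by auto
    qed (use that in simp)
    obtain i where i: "i \<in> I" using cl(1) mIJ(1) by fastforce
    then have "s - 1 \<in> I" using up[OF i, of "s - 1 - i"] mIJ(3) by auto
    then have "0 \<in> I" using step[of "s - 1"] s by auto
    then have "{0..<s} \<subseteq> I" using up[of 0] by auto
    then have "I = {0..<s}" using mIJ(3) by auto
    then show False using cl(1) mIJ(2) by simp
  qed
  then show ?thesis using A by (auto simp: indec_Lambda3_def)
qed

section \<open>Upper bounds for \<open>mu1\<close>\<close>

lemma mu1_le:
  assumes "s \<ge> 3" "\<And>A. A \<in> indec_Lambda3 s \<Longrightarrow> permanent A \<le> k"
  shows "mu1 s \<le> k"
  unfolding mu1_def using assms circ3_indec[OF assms(1)] finite_ps_indec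
  by (subst Max_le_iff) (auto simp: ps_def)

text \<open>Splitting off order 4 loses nothing since \<open>9^2 = 3^4\<close>. The step starts at 8
  because \<open>r - 4\<close> must again be at least 4.\<close>

lemma mu1_sq_le:
  assumes submult: "\<forall>n1\<ge>3. \<forall>n2\<ge>3. mu1 (n1 + n2) \<le> mu1 n1 * mu1 n2" and "r \<ge> 4"
  shows "(mu1 r)\<^sup>2 \<le> 3 ^ r"
  using \<open>r \<ge> 4\<close>
proof (induction r rule: less_induct)
  case (less r)
  have base: "mu1 4 \<le> 9" "mu1 5 \<le> 15" "mu1 6 \<le> 27" "mu1 7 \<le> 46"
    using permanent_indec_bounds by (auto intro!: mu1_le)
  consider "r = 4" | "r = 5" | "r = 6" | "r = 7" | "r \<ge> 8" using less.prems by linarith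
  then show ?case
  proof cases
    case 5
    have "mu1 r \<le> mu1 4 * mu1 (r - 4)"
      using submult[rule_format, of 4 "r - 4"] 5 by simp
    then have "(mu1 r)\<^sup>2 \<le> (mu1 4)\<^sup>2 * (mu1 (r - 4))\<^sup>2"
      by (metis power_mono power_mult_distrib zero_le)
    also have "\<dots> \<le> 9\<^sup>2 * 3 ^ (r - 4)"
      using base(1) less.IH[of "r - 4"] 5 by (intro mult_mono power_mono) auto
    also have "9\<^sup>2 * 3 ^ (r - 4) = (3 ^ r :: nat)"
      using 5 power_add[of "3 :: nat" 4 "r - 4"] by simp
    finally show ?thesis .
  next
    case 1
    have "(mu1 4)\<^sup>2 \<le> 9\<^sup>2" by (intro power_mono base) simp
    then show ?thesis unfolding 1 by simp
  next
    case 2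
    have "(mu1 5)\<^sup>2 \<le> 15\<^sup>2" by (intro power_mono base) simp
    then show ?thesis unfolding 2 by simp
  next
    case 3
    have "(mu1 6)\<^sup>2 \<le> 27\<^sup>2" by (intro power_mono base) simp
    then show ?thesis unfolding 3 by simp
  next
    case 4
    have "(mu1 7)\<^sup>2 \<le> 46\<^sup>2" by (intro power_mono base) simp
    then show ?thesis unfolding 4 by simp
  qed
qed

section \<open>Small orders and direct sums\<close>

lemma ps_Lambda3_3: "ps (Lambda3 3) = {6}"
proof -
  have "permanent A = 6" if A: "A \<in> Lambda3 3" for A
  proof -
    have r: "row_supp A i = {0, 1, 2}" if "i < 3" for i
    proof -
      have "row_supp A i = {0..<3}"
        using row_supp_subset[OF A, of i] A that by (intro card_subset_eq) (auto simp: Lambda3_iff_supp)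
      also have "{0..<3} = {0, 1, 2 :: nat}" by auto
      finally show ?thesis .
    qed
    have "permanent A = sdr [{0, 1, 2}, {0, 1, 2}, {0, 1, 2 :: nat}]"
    proof -
      have "[0..<3] = [0, 1, 2 :: nat]" by (simp add: upt_rec)
      then show ?thesis using permanent_Lambda3[OF A] by (simp add: r)
    qed
    also have "\<dots> = 6" by (simp add: sdr_Cons insert_Diff_if)
    finally show ?thesis .
  qed
  then show ?thesis using circ3_in_Lambda3[of 3] by (force simp: ps_def)
qed

lemma Lambda3_empty: "n = 1 \<or> n = 2 \<Longrightarrow> Lambda3 n = {}"
proof (rule ccontr)
  assume n: "n = 1 \<or> n = 2" and "Lambda3 n \<noteq> {}"
  then obtain A where A: "A \<in> Lambda3 n" by auto
  have "card (row_supp A 0) \<le> card {0..<n}"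
    by (intro card_mono row_supp_subset[OF A]) simp
  then show False using A n by (auto simp: Lambda3_iff_supp)
qed

lemma ps_Lambda3_0: "ps (Lambda3 0) = {1}"
proof -
  have "permanent A = 1" if "A \<in> Lambda3 0" for A
    using permanent_Lambda3[OF that] by simp
  moreover have "mat 0 0 (\<lambda>_. 0) \<in> Lambda3 0" by (simp add: Lambda3_def)
  ultimately show ?thesis by (force simp: ps_def)
qed

text \<open>The block-diagonal matrix has the supports of \<open>A\<close> and those of
  \<open>B\<close> shifted by \<open>a\<close>, which are disjoint.\<close>

lemma ps_Lambda3_mult:
  assumes "x \<in> ps (Lambda3 a)" "y \<in> ps (Lambda3 b)"
  shows "x * y \<in> ps (Lambda3 (a + b))"
proof -
  obtain A B where A: "A \<in> Lambda3 a" "x = permanent A" and B: "B \<in> Lambda3 b" "y = permanent B"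
    using assms by (auto simp: ps_def)
  define M where "M = four_block_mat A (0\<^sub>m a b) (0\<^sub>m b a) B"
  have dA: "dim_row A = a" "dim_col A = a" using A by (auto simp: Lambda3_def)
  have dB: "dim_row B = b" "dim_col B = b" using B by (auto simp: Lambda3_def)
  have M: "M $$ (i, j) = (if i < a then if j < a then A $$ (i, j) else 0
      else if j < a then 0 else B $$ (i - a, j - a))" if "i < a + b" "j < a + b" for i j
    using that by (simp add: M_def dA dB)
  have dM: "dim_row M = a + b" "dim_col M = a + b" by (simp_all add: M_def dA dB)
  have r1: "row_supp M i = row_supp A i" if "i < a" for i
    using that by (auto simp: row_supp_def dA dM M split: if_splits)
  have r2: "row_supp M (a + i) = (+) a ` row_supp B i" if "i < b" for i
  proof (intro equalityI subsetI)
    fix j assume "j \<in> row_supp M (a + i)"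
    then have "j < a + b" "M $$ (a + i, j) = 1" by (auto simp: row_supp_def dM)
    then have "j \<ge> a" "j - a \<in> row_supp B i" using that by (auto simp: M row_supp_def dB split: if_splits)
    then show "j \<in> (+) a ` row_supp B i" by (auto intro!: image_eqI[of _ _ "j - a"])
  qed (use that in \<open>auto simp: row_supp_def dM dB M\<close>)
  have c1: "col_supp M j = col_supp A j" if "j < a" for j
    using that by (auto simp: col_supp_def dA dM M split: if_splits)
  have c2: "col_supp M (a + j) = (+) a ` col_supp B j" if "j < b" for j
  proof (intro equalityI subsetI)
    fix i assume "i \<in> col_supp M (a + j)"
    then have "i < a + b" "M $$ (i, a + j) = 1" by (auto simp: col_supp_def dM)
    then have "i \<ge> a" "i - a \<in> col_supp B j" using that by (auto simp: M col_supp_def dB split: if_splits)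
    then show "i \<in> (+) a ` col_supp B j" by (auto intro!: image_eqI[of _ _ "i - a"])
  qed (use that in \<open>auto simp: col_supp_def dM dB M\<close>)
  have shift: "i < a \<or> (\<exists>k<b. i = a + k)" if "i < a + b" for i
    using that by (metis add_diff_inverse_nat less_diff_conv2 not_less nat_add_left_cancel_less)
  have "card (row_supp M i) = 3" "card (col_supp M i) = 3" if "i < a + b" for i
    using shift[OF that] A(1) B(1) by (auto simp: r1 r2 c1 c2 Lambda3_iff_supp card_image)
  moreover have "M \<in> carrier_mat (a + b) (a + b)" using dM by auto
  moreover have "M $$ (i, j) \<in> {0, 1}" if "i < a + b" "j < a + b" for i j
    using A(1) B(1) that by (auto simp: M Lambda3_def)
  ultimately have M3: "M \<in> Lambda3 (a + b)" by (simp add: Lambda3_iff_supp)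
  have "map (row_supp M) [0..<a + b] = map (row_supp A) [0..<a] @ map (image ((+) a)) (map (row_supp B) [0..<b])"
    by (intro nth_equalityI) (auto simp: nth_append r1 r2[symmetric] not_less)
  moreover have "sdr (map (row_supp A) [0..<a] @ map (image ((+) a)) (map (row_supp B) [0..<b])) =
      sdr (map (row_supp A) [0..<a]) * sdr (map (image ((+) a)) (map (row_supp B) [0..<b]))"
    using row_supp_subset[OF A(1)] by (intro sdr_append) fastforce
  moreover have "sdr (map (image ((+) a)) (map (row_supp B) [0..<b])) = sdr (map (row_supp B) [0..<b])"
    by (intro sdr_image) simp
  ultimately have "permanent M = x * y"
    using permanent_Lambda3[OF M3] permanent_Lambda3[OF A(1)] permanent_Lambda3[OF B(1)] A(2) B(2)
    by simp
  then show ?thesis using M3 by (auto simp: ps_def intro!: image_eqI[of _ _ M])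
qed

section \<open>The largest permanents\<close>

text \<open>\<^const>\<open>pi4\<close> without the convention at \<open>3\<close>, so that it is closed under products.\<close>
definition big_prods :: "nat \<Rightarrow> nat set" where
  "big_prods m = {prod_mset X | rho X. sum_mset rho = m \<and> (\<forall>r \<in># rho. 4 \<le> r) \<and>
     rel_mset (\<lambda>r x. x \<in> ps (indec_Lambda3 r)) rho X}"

lemma pi4_eq: "pi4 m = (if m = 3 then {6} else big_prods m)"
  by (simp add: pi4_def big_prods_def)

text \<open>Peels off one block at a time; the empty partition of 0 contributes the value 1.\<close>

lemma big_prods_induct [consumes 1, case_names one mult]:
  assumes "y \<in> big_prods m"
    and one: "P 0 1"
    and mult: "\<And>r x m y. 4 \<le> r \<Longrightarrow> x \<in> ps (indec_Lambda3 r) \<Longrightarrow> y \<in> big_prods m \<Longrightarrow> P m y \<Longrightarrow>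
      P (r + m) (x * y)"
  shows "P m y"
proof -
  obtain rho X where X: "y = prod_mset X" "sum_mset rho = m" "\<forall>r \<in># rho. 4 \<le> r"
    "rel_mset (\<lambda>r x. x \<in> ps (indec_Lambda3 r)) rho X"
    using assms(1) by (auto simp: big_prods_def)
  from X(4) X(3) have "P (sum_mset rho) (prod_mset X)"
  proof (induction "\<lambda>r x. x \<in> ps (indec_Lambda3 r)" rho X rule: rel_mset_induct)
    case empty
    then show ?case using one by simp
  next
    case (add r x M N)
    then have "prod_mset N \<in> big_prods (sum_mset M)" by (auto simp: big_prods_def)
    then show ?case using add by (auto intro!: mult)
  qed
  then show ?thesis using X by simp
qed

lemma one_in_big_prods: "1 \<in> big_prods 0"
  unfolding big_prods_def by (intro CollectI exI[of _ "{#}"]) simp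

lemma mult_in_big_prods:
  assumes "4 \<le> r" "x \<in> ps (indec_Lambda3 r)" "y \<in> big_prods m"
  shows "x * y \<in> big_prods (r + m)"
proof -
  obtain rho X where X: "y = prod_mset X" "sum_mset rho = m" "\<forall>r \<in># rho. 4 \<le> r"
    "rel_mset (\<lambda>r x. x \<in> ps (indec_Lambda3 r)) rho X"
    using assms(3) by (auto simp: big_prods_def)
  have "rel_mset (\<lambda>r x. x \<in> ps (indec_Lambda3 r)) (add_mset r rho) (add_mset x X)"
    using assms(2) X(4) by (intro rel_mset_Plus)
  moreover have "sum_mset (add_mset r rho) = r + m" "prod_mset (add_mset x X) = x * y"
    "\<forall>s \<in># add_mset r rho. 4 \<le> s"
    using X assms(1) by auto
  ultimately show ?thesis
    unfolding big_prods_def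
    by - (rule CollectI, rule exI[of _ "add_mset r rho"], rule exI[of _ "add_mset x X"], auto)
qed

lemma big_prods_mult:
  assumes "x \<in> big_prods a" "y \<in> big_prods b"
  shows "x * y \<in> big_prods (a + b)"
  using assms(1)
proof (induction rule: big_prods_induct)
  case one
  then show ?case using assms(2) by simp
next
  case (mult r x m z)
  then show ?case using mult_in_big_prods[of r x "z * y" "m + b"] by (simp add: ac_simps)
qed

lemma big_prods_subset_ps: "y \<in> big_prods m \<Longrightarrow> y \<in> ps (Lambda3 m)"
proof (induction rule: big_prods_induct)
  case one
  then show ?case by (simp add: ps_Lambda3_0)
next
  case (mult r x m y)
  then have "x \<in> ps (Lambda3 r)" using indec_Lambda3_subset by (auto simp: ps_def)
  then show ?case using mult by (intro ps_Lambda3_mult)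
qed

lemma big_prods_empty: "m = 1 \<or> m = 2 \<Longrightarrow> big_prods m = {}"
  using big_prods_subset_ps[of _ m] Lambda3_empty[of m] by (auto simp: ps_def)

lemma big_prods_0: "y \<in> big_prods 0 \<Longrightarrow> y = 1"
  using big_prods_subset_ps[of y 0] by (simp add: ps_Lambda3_0)

lemma power_6_in_ps: "6 ^ k \<in> ps (Lambda3 (3 * k))"
proof (induction k)
  case (Suc k)
  then show ?case using ps_Lambda3_mult[of 6 3 "6 ^ k" "3 * k"] ps_Lambda3_3 by simp
qed (simp add: ps_Lambda3_0)

text \<open>A matrix that is not indecomposable splits into two smaller factors, so splitting ends
  in indecomposable blocks. Those of order 3 supply the powers of 6, the larger ones the factor from
  \<open>big_prods\<close>.\<close>

lemma ps_Lambda3_decompose: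
  assumes "x \<in> ps (Lambda3 n)"
  shows "\<exists>a m y. n = 3 * a + m \<and> x = 6 ^ a * y \<and> y \<in> big_prods m"
  using assms
proof (induction n arbitrary: x rule: less_induct)
  case (less n)
  then obtain A where A: "A \<in> Lambda3 n" "x = permanent A" by (auto simp: ps_def)
  show ?case
  proof (cases "A \<in> indec_Lambda3 n")
    case True
    consider "n = 0" | "n = 3" | "n \<ge> 4"
      using A(1) Lambda3_empty[of n] by fastforce
    then show ?thesis
    proof cases
      case 1
      then have "x = 1" using less.prems ps_Lambda3_0 by auto
      then show ?thesis
        using 1 one_in_big_prods by (intro exI[of _ 0] exI[of _ "1 :: nat"]) simp
    next
      case 2
      then have "x = 6" using less.prems ps_Lambda3_3 by auto
      then show ?thesis
        using 2 one_in_big_prods by (intro exI[of _ 1] exI[of _ 0] exI[of _ "1 :: nat"]) simp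
    next
      case 3
      have "x \<in> ps (indec_Lambda3 n)" using True A(2) by (auto simp: ps_def)
      then have "x * 1 \<in> big_prods (n + 0)" using 3 one_in_big_prods by (intro mult_in_big_prods)
      then show ?thesis by (intro exI[of _ 0] exI[of _ n] exI[of _ x]) simp
    qed
  next
    case False
    then obtain m I J where mIJ: "0 < m" "m < n" "I \<subseteq> {0..<n}" "J \<subseteq> {0..<n}" "submatrix A I J \<in> Lambda3 m"
      using A(1) by (auto simp: indec_Lambda3_def)
    obtain B where B: "B \<in> Lambda3 (n - m)" "permanent A = permanent (submatrix A I J) * permanent B"
      using Lambda3_split[OF A(1) mIJ(3-5)] .
    have "permanent (submatrix A I J) \<in> ps (Lambda3 m)" using mIJ by (auto simp: ps_def)
    then obtain a k y where 1: "m = 3 * a + k" "permanent (submatrix A I J) = 6 ^ a * y" "y \<in> big_prods k"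
      using less.IH[OF mIJ(2)] by blast
    have "n - m < n" "permanent B \<in> ps (Lambda3 (n - m))" using mIJ B by (auto simp: ps_def)
    then obtain b l z where 2: "n - m = 3 * b + l" "permanent B = 6 ^ b * z" "z \<in> big_prods l"
      using less.IH by blast
    have "n = 3 * (a + b) + (k + l)" using 1(1) 2(1) mIJ(2) by simp
    moreover have "x = 6 ^ (a + b) * (y * z)" using A(2) B(2) 1(2) 2(2) by (simp add: power_add)
    ultimately show ?thesis using big_prods_mult[OF 1(3) 2(3)] by blast
  qed
qed

lemma big_prods_sq_le:
  assumes submult: "\<forall>n1\<ge>3. \<forall>n2\<ge>3. mu1 (n1 + n2) \<le> mu1 n1 * mu1 n2"
  shows "y \<in> big_prods m \<Longrightarrow> y\<^sup>2 \<le> 3 ^ m"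
proof (induction rule: big_prods_induct)
  case (mult r x m y)
  have "x\<^sup>2 \<le> (mu1 r)\<^sup>2" using ps_indec_le_mu1[OF mult(2)] by (simp add: power_mono)
  also have "\<dots> \<le> 3 ^ r" by (rule mu1_sq_le[OF submult mult(1)])
  finally have "x\<^sup>2 * y\<^sup>2 \<le> 3 ^ r * 3 ^ m" using mult by (intro mult_mono) auto
  then show ?case by (simp add: power_mult_distrib power_add)
qed simp

lemma big_prods_less:
  assumes submult: "\<forall>n1\<ge>3. \<forall>n2\<ge>3. mu1 (n1 + n2) \<le> mu1 n1 * mu1 n2"
    and y: "y \<in> big_prods (4 * k + 3 * e)" and e: "e > 0"
  shows "y < 9 ^ k * 6 ^ e"
proof -
  have "y\<^sup>2 \<le> 3 ^ (4 * k + 3 * e)" using big_prods_sq_le[OF submult y] .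
  also have "\<dots> = 81 ^ k * 27 ^ e" by (simp add: power_add power_mult)
  also have "\<dots> < 81 ^ k * 36 ^ e" using power_strict_mono[of "27 :: nat" 36 e] e by simp
  also have "\<dots> = (9 ^ k * 6 ^ e)\<^sup>2"
  proof -
    have "(9 ^ k)\<^sup>2 = (81 ^ k :: nat)" "(6 ^ e)\<^sup>2 = (36 ^ e :: nat)"
      by (simp_all add: power2_eq_square flip: power_mult_distrib)
    then show ?thesis by (simp add: power_mult_distrib)
  qed
  finally show ?thesis by (rule power_less_imp_less_base) simp
qed

theorem theorem9:
  fixes n j t :: nat
  assumes submult: "\<forall>n1\<ge>3. \<forall>n2\<ge>3. mu1 (n1 + n2) \<le> mu1 n1 * mu1 n2"
    and "n \<ge> 3" and "j \<in> {0, 1, 2}" and "[n = j] (mod 3)"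
    and "n \<ge> 4 * (3 * t + j)"
  shows "E n j t \<subseteq> ps (Lambda3 n) \<and>
         (\<forall>x \<in> ps (Lambda3 n) - E n j t. \<forall>y \<in> E n j t. x < y)"
proof -
  \<comment> \<open>\<open>k\<close> blocks of size \<open>4\<close> and \<open>q - l\<close> blocks of size \<open>3\<close> fill \<open>n\<close> rows and yield the threshold \<open>?T\<close> below.\<close>
  define k where "k = 3 * t + j"
  define l where "l = 4 * t + j"
  have j: "j \<le> 2" using assms(3) by auto
  have "n mod 3 = j" using assms(4) j by (simp add: cong_def)
  then obtain q where n: "n = 3 * q + j" by (metis mult_div_mod_eq)
  have lq: "l \<le> q" using assms(5) n by (simp add: l_def)
  have lk: "3 * l + j = 4 * k" by (simp add: k_def l_def)
  have expo: "(n - j - 3 * i) div 3 = q - i" for i by (simp add: n flip: diff_mult_distrib2)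
  \<comment> \<open>After multiplication by \<open>6 ^ (q - i)\<close> the threshold in the
    definition of \<open>E\<close> no longer depends on \<open>i\<close>, and as
    \<open>l \<le> q\<close> it becomes a natural number.\<close>
  have thr: "real y \<ge> 9 ^ (3 * t + j) * 6 powi (int i - 4 * int t - int j) \<longleftrightarrow>
      9 ^ k * 6 ^ (q - l) \<le> 6 ^ (q - i) * y" if "i \<le> l" for i y
  proof -
    have pw: "(6 :: real) powi (int i - 4 * int t - int j) = 6 ^ i / 6 ^ l"
    proof -
      have eq: "int i - 4 * int t - int j = int i - int l" by (simp add: l_def)
      show ?thesis unfolding eq by (simp add: power_int_diff)
    qed
    have "real y \<ge> 9 ^ (3 * t + j) * 6 powi (int i - 4 * int t - int j) \<longleftrightarrow>
        9 ^ k * 6 ^ i \<le> (6 :: real) ^ l * real y"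
      unfolding pw k_def[symmetric] by (simp add: field_simps)
    also have "\<dots> \<longleftrightarrow> 6 ^ (q - l) * (9 ^ k * 6 ^ i) \<le> 6 ^ (q - l) * ((6 :: real) ^ l * real y)"
      by simp
    also have "6 ^ (q - l) * (9 ^ k * 6 ^ i) = (6 :: real) ^ i * (9 ^ k * 6 ^ (q - l))" by simp
    also have "6 ^ (q - l) * ((6 :: real) ^ l * real y) = 6 ^ i * (6 ^ (q - i) * real y)"
      using that lq by (simp flip: mult.assoc power_add)
    also have "6 ^ i * (9 ^ k * 6 ^ (q - l)) \<le> 6 ^ i * (6 ^ (q - i) * real y) \<longleftrightarrow>
        real (9 ^ k * 6 ^ (q - l)) \<le> real (6 ^ (q - i) * y)"
      by simp
    finally show ?thesis by (simp only: of_nat_le_iff)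
  qed
  let ?T = "9 ^ k * 6 ^ (q - l) :: nat"
  have E: "x \<in> E n j t \<longleftrightarrow> (\<exists>i y. 1 \<le> i \<and> i \<le> l \<and> x = 6 ^ (q - i) * y \<and> y \<in> pi4 (3 * i + j) \<and> ?T \<le> x)" for x
  proof -
    have "x \<in> E n j t \<longleftrightarrow> (\<exists>i\<in>{1..l}. \<exists>y. x = 6 ^ (q - i) * y \<and> y \<in> pi4 (3 * i + j) \<and>
        real y \<ge> 9 ^ (3 * t + j) * 6 powi (int i - 4 * int t - int j))"
      unfolding E_def expo l_def by blast
    also have "\<dots> \<longleftrightarrow> (\<exists>i\<in>{1..l}. \<exists>y. x = 6 ^ (q - i) * y \<and> y \<in> pi4 (3 * i + j) \<and> ?T \<le> x)"
      using thr by (intro bex_cong ex_cong1 conj_cong refl) auto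
    finally show ?thesis by auto
  qed
  have E_sub: "x \<in> ps (Lambda3 n)" if x: "x \<in> E n j t" for x
  proof -
    obtain i y where i: "1 \<le> i" "i \<le> l" "x = 6 ^ (q - i) * y" "y \<in> pi4 (3 * i + j)"
      using x unfolding E by blast
    have "y \<in> ps (Lambda3 (3 * i + j))"
      using i(4) big_prods_subset_ps ps_Lambda3_3 by (auto simp: pi4_eq split: if_splits)
    then have "x \<in> ps (Lambda3 (3 * (q - i) + (3 * i + j)))"
      unfolding i(3) by (intro ps_Lambda3_mult power_6_in_ps)
    moreover have "3 * (q - i) + (3 * i + j) = n" using i(2) lq n by simp
    ultimately show ?thesis by simp
  qed
  \<comment> \<open>For \<open>l = 0\<close> this would fail: then \<open>j = t = 0\<close>, the
    threshold is \<open>6 ^ q\<close>, and \<open>6 ^ q\<close> is itself a permanent, while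
    \<open>E\<close> is empty.\<close>
  have below: "x < ?T" if x: "x \<in> ps (Lambda3 n)" "x \<notin> E n j t" and l0: "l > 0" for x
  proof -
    obtain a m y where y: "n = 3 * a + m" "x = 6 ^ a * y" "y \<in> big_prods m"
      using ps_Lambda3_decompose[OF x(1)] by blast
    have "m mod 3 = j" using y(1) n j by presburger
    then obtain i where m: "m = 3 * i + j" by (metis mult_div_mod_eq)
    have a: "a = q - i" "i \<le> q" using y(1) n m by auto
    consider "i = 0" | "1 \<le> i" "i \<le> l" | "l < i" by linarith
    then show ?thesis
    proof cases
      case 1
      then have "j = 0" using y(3) m j big_prods_empty[of j] by (cases "j = 0") fastforce+
      then have "y = 1" using y(3) m 1 big_prods_0 by simp
      \<comment> \<open>The value \<open>6 ^ q\<close> has \<open>i = 0\<close>, whereas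
        \<open>E\<close> starts at \<open>i = 1\<close>; the convention for \<open>pi4 3\<close>
        lets it appear there with one factor 6 moved into \<open>y\<close>.\<close>
      have "x = 6 ^ (q - 1) * 6"
        using \<open>y = 1\<close> y(2) a 1 l0 lq by (simp flip: power_Suc2)
      moreover have "6 \<in> pi4 (3 * 1 + j)" using \<open>j = 0\<close> by (simp add: pi4_eq)
      moreover have "1 \<le> l" using l0 by simp
      ultimately have "\<not> ?T \<le> x" using x(2) unfolding E by blast
      then show ?thesis by simp
    next
      case 2
      have "y \<in> pi4 m"
      proof (cases "m = 3")
        case True
        \<comment> \<open>No partition of 3 has all parts at least 4, so this case is vacuous; the
          inclusion in \<open>ps (Lambda3 3)\<close> already gives the value demanded by the
          convention.\<close>
        then have "x \<in> ps (Lambda3 n)" "y = 6" 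
          using x y(3) big_prods_subset_ps ps_Lambda3_3 by auto
        then show ?thesis using True by (simp add: pi4_eq)
      qed (use y(3) in \<open>simp add: pi4_eq\<close>)
      then have "\<not> ?T \<le> x" using x(2) 2 y(2) unfolding E m a(1) by blast
      then show ?thesis by simp
    next
      case 3
      \<comment> \<open>At \<open>i = l\<close> the order \<open>3 * i + j\<close> is exactly
        \<open>4 * k\<close>; each further unit of \<open>i\<close> adds 3 rows, for which a factor
        6 would have been available.\<close>
      have "m = 4 * k + 3 * (i - l)" using m lk 3 by simp
      then have "y < 9 ^ k * 6 ^ (i - l)"
        using big_prods_less[OF submult, of y k "i - l"] y(3) 3 by simp
      then have "x < 6 ^ a * (9 ^ k * 6 ^ (i - l))" using y(2) by simp
      also have "\<dots> = 9 ^ k * 6 ^ (a + (i - l))" by (simp add: power_add)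
      also have "a + (i - l) = q - l" using a 3 by simp
      finally show ?thesis .
    qed
  qed
  have "x < y" if "x \<in> ps (Lambda3 n) - E n j t" "y \<in> E n j t" for x y
  proof -
    have "?T \<le> y" "l > 0" using that(2) unfolding E by auto
    then show ?thesis using below[of x] that(1) by fastforce
  qed
  then show ?thesis using E_sub by blast
qed

end
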